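(* Let $0<\alpha<1$. The fractional initial value problem $$({}^{ABC}{}_{0}D^\alpha u)(t)=\lambda u(t)+f(t),\quad t>0,\qquad u(0)=u_0,$$ has the unique solution $$u(t)=\frac{1}{B(\alpha)-\lambda(1-\alpha)}\Bigl(B(\alpha)\,u_0\,E_\alpha[\omega t^\alpha]+(1-\alpha)\bigl(g(t)*f'(t)+f(0)\,g(t)\bigr)\Bigr)$$ in the function space $H^1(0,b)\cap C[0,b]$ if and only if $\lambda u_0+f(0)=0$, where $$\omega=\frac{\lambda\alpha}{B(\alpha)-\lambda(1-\alpha)},\qquad g(t)=E_\alpha[\omega t^\alpha]+\frac{\alpha}{1-\alpha}\,\frac{t^{\alpha-1}}{\Gamma(\alpha)}*E_\alpha[\omega t^\alpha].$$
   Context: Here $b>0$, $\lambda$ and $u_0$ are real constants, and $f$ is a given real-valued function of $t$ with derivative $f'$. $E_\alpha(z)=\sum_{k\ge 0} z^k/\Gamma(\alpha k+1)$ is the Mittag-Leffler function, and $B$ is a normalization function with $B(\alpha)>0$ and $B(0)=B(1)=1$. $H^1(0,b)$ is the Sobolev space. The symbol $*$ denotes the Laplace convolution $(\varphi*\psi)(t)=\int_0^t\varphi(t-s)\psi(s)\,ds$. For $u\in H^1(0,b)$ and $\alpha\in(0,1)$, the left Caputo fractional derivative with Mittag-Leffler non-singular kernel is $$({}^{ABC}{}_{0}D^\alpha u)(t)=\frac{B(\alpha)}{1-\alpha}\int_0^t E_\alpha\!\left[-\frac{\alpha}{1-\alpha}(t-s)^\alpha\right] u'(s)\,ds.$$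
   Formalization: The function f is assumed to lie in H^1(0,b)∩C[0,b], with f' its weak derivative (the claim fails otherwise, e.g. f(t)=√t, λ=u_0=0), and B(α)−λ(1−α)≠0 is assumed so that ω and u are defined. *)

theory Defs
  imports "HOL-Analysis.Analysis"
begin

definition mittag_leffler :: "real \<Rightarrow> real \<Rightarrow> real" where
  "mittag_leffler \<alpha> z = (\<Sum>k. z ^ k / Gamma (\<alpha> * real k + 1))"

definition laplace_conv :: "(real \<Rightarrow> real) \<Rightarrow> (real \<Rightarrow> real) \<Rightarrow> real \<Rightarrow> real" where
  "laplace_conv \<phi> \<psi> t = (LINT s:{0..t}|lebesgue. \<phi> (t - s) * \<psi> s)"

definition square_integrable_on :: "(real \<Rightarrow> real) \<Rightarrow> real set \<Rightarrow> bool" where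
  "square_integrable_on f I \<longleftrightarrow>
     set_borel_measurable lebesgue I f \<and> set_integrable lebesgue I (\<lambda>x. (f x)\<^sup>2)"

text \<open>Sobolev spaces on an interval, following Brezis: test functions are of class C1 with
  compact support in the open set \<open>I\<close>.\<close>

definition test_functions :: "real set \<Rightarrow> (real \<Rightarrow> real) set" where
  "test_functions I =
     {\<phi>. \<phi> C1_differentiable_on UNIV \<and>
         compact (closure {x. \<phi> x \<noteq> 0}) \<and> closure {x. \<phi> x \<noteq> 0} \<subseteq> I}"

definition has_L2_weak_derivative_on ::
    "(real \<Rightarrow> real) \<Rightarrow> (real \<Rightarrow> real) \<Rightarrow> real set \<Rightarrow> bool" where
  "has_L2_weak_derivative_on u w I \<longleftrightarrow>
     square_integrable_on u I \<and> square_integrable_on w I \<and>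
     (\<forall>\<phi> \<in> test_functions I.
        (LINT x:I|lebesgue. u x * deriv \<phi> x) = - (LINT x:I|lebesgue. w x * \<phi> x))"

definition H1 :: "real set \<Rightarrow> (real \<Rightarrow> real) set" where
  "H1 I = {u. \<exists>w. has_L2_weak_derivative_on u w I}"

text \<open>An arbitrary representative: the weak derivative is determined only up to null sets,
  and it is only ever used under an integral sign.\<close>

definition weak_derivative :: "real set \<Rightarrow> (real \<Rightarrow> real) \<Rightarrow> real \<Rightarrow> real" where
  "weak_derivative I u = (SOME w. has_L2_weak_derivative_on u w I)"

text \<open>Functions on \<open>[0,b]\<close> are represented by total functions whose values outside \<open>[0,b]\<close>
  are irrelevant. An element of \<open>H\<^sup>1(0,b) \<inter> C[0,b]\<close> is given by its continuous representative,
  so that point values, in particular the one at \<open>0\<close>, make sense.\<close>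

definition H1C :: "real \<Rightarrow> (real \<Rightarrow> real) set" where
  "H1C b = H1 {0<..<b} \<inter> {u. continuous_on {0..b} u}"

definition ABC_derivative ::
    "(real \<Rightarrow> real) \<Rightarrow> real \<Rightarrow> real \<Rightarrow> (real \<Rightarrow> real) \<Rightarrow> real \<Rightarrow> real" where
  "ABC_derivative B b \<alpha> u t =
     B \<alpha> / (1 - \<alpha>) *
       (LINT s:{0..t}|lebesgue.
          mittag_leffler \<alpha> (- (\<alpha> / (1 - \<alpha>)) * (t - s) powr \<alpha>) * weak_derivative {0<..<b} u s)"

text \<open>The equation is imposed for \<open>t > 0\<close> only, not at \<open>t = 0\<close>.\<close>

definition solves_ivp ::
    "(real \<Rightarrow> real) \<Rightarrow> real \<Rightarrow> real \<Rightarrow> real \<Rightarrow> (real \<Rightarrow> real) \<Rightarrow> real \<Rightarrow> (real \<Rightarrow> real) \<Rightarrow> bool" where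
  "solves_ivp B b \<alpha> lam f u0 u \<longleftrightarrow>
     (\<forall>t \<in> {0<..b}. ABC_derivative B b \<alpha> u t = lam * u t + f t) \<and> u 0 = u0"

definition is_unique_solution ::
    "(real \<Rightarrow> real) \<Rightarrow> real \<Rightarrow> real \<Rightarrow> real \<Rightarrow> (real \<Rightarrow> real) \<Rightarrow> real \<Rightarrow> (real \<Rightarrow> real) \<Rightarrow> bool" where
  "is_unique_solution B b \<alpha> lam f u0 u \<longleftrightarrow>
     u \<in> H1C b \<and> solves_ivp B b \<alpha> lam f u0 u \<and>
     (\<forall>v \<in> H1C b. solves_ivp B b \<alpha> lam f u0 v \<longrightarrow> (\<forall>t \<in> {0..b}. v t = u t))"

end

theory Submission
  imports Defs
begin

text \<open>
  Write \<open>*\<close> for the convolution, \<open>h(t) = t\<^sup>\<alpha>\<^sup>-\<^sup>1/\<Gamma>(\<alpha>)\<close>, \<open>\<mu> = \<alpha>/(1 - \<alpha>)\<close>, \<open>D = B(\<alpha>) - \<lambda>(1 - \<alpha>)\<close>,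
  \<open>e(t) = E\<^sub>\<alpha>(\<omega> t\<^sup>\<alpha>)\<close> and \<open>k(t) = E\<^sub>\<alpha>(- \<mu> t\<^sup>\<alpha>)\<close>, so that the fractional derivative of \<open>u\<close> is
  \<open>B(\<alpha>)/(1 - \<alpha>) k * u'\<close>. The integral equations \<open>e = 1 + \<omega> h * e\<close> and \<open>k = 1 - \<mu> h * k\<close>, which
  come from the Beta integral, turn \<open>g = e + \<mu> h * e\<close> into the resolvent kernel of the problem:
  \<open>k * g = 1 * e\<close> and \<open>B(\<alpha>) e - \<lambda>(1 - \<alpha>) g = D\<close>.

  Necessity: \<open>k * u'\<close> is continuous and vanishes at \<open>0\<close>. Uniqueness: if \<open>\<delta>\<close> is the weak derivative
  of the difference of two solutions, convolving \<open>B(\<alpha>) k * \<delta> = \<lambda>(1 - \<alpha>) (1 * \<delta>)\<close> with \<open>g\<close> gives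
  \<open>D (1 * 1 * \<delta>) = 0\<close>. Existence: when \<open>\<lambda> u\<^sub>0 + f(0) = 0\<close>, the non-convolution part of the formula
  collapses to the constant \<open>u\<^sub>0\<close>, and \<open>u = u\<^sub>0 + (1 - \<alpha>)/D g * f'\<close>. This lies in \<open>H\<^sup>1\<close> although \<open>g'\<close>
  need not be square integrable, because \<open>g' * f'\<close> is, by Young's inequality.
\<close>

section \<open>Convolution\<close>

text \<open>Borel measurability is required on the whole line, so that \<open>p (t - s)\<close> is
  jointly measurable in both variables and Fubini's theorem applies; only integrability is local to
  the interval.\<close>

definition integrable_to :: "real \<Rightarrow> (real \<Rightarrow> real) \<Rightarrow> bool" where
  "integrable_to b p \<longleftrightarrow> p \<in> borel_measurable borel \<and> set_integrable lborel {0..b} p"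

text \<open>Continuity on \<open>{0..b}\<close> gives boundedness there, so the convolution of such
  a kernel with an integrable function exists at every point and not merely almost
  everywhere.\<close>

definition kernel_on :: "real \<Rightarrow> (real \<Rightarrow> real) \<Rightarrow> bool" where
  "kernel_on b p \<longleftrightarrow> p \<in> borel_measurable borel \<and> continuous_on {0..b} p"

lemma integrable_to_measurable [measurable_dest]:
  "integrable_to b p \<Longrightarrow> p \<in> borel_measurable borel"
  by (simp add: integrable_to_def)

lemma kernel_on_measurable [measurable_dest]: "kernel_on b p \<Longrightarrow> p \<in> borel_measurable borel"
  by (simp add: kernel_on_def)

lemma kernel_on_integrable_to: "kernel_on b p \<Longrightarrow> integrable_to b p"
  using borel_integrable_compact[of "{0..b}" p]
  by (simp add: kernel_on_def integrable_to_def set_integrable_def if_distrib indicator_def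
      if_distribR cong: if_cong)

lemma kernel_on_bounded:
  assumes "kernel_on b p"
  obtains M where "M \<ge> 0" "\<And>x. x \<in> {0..b} \<Longrightarrow> \<bar>p x\<bar> \<le> M"
proof -
  have "compact (p ` {0..b})"
    using assms by (auto simp: kernel_on_def intro: compact_continuous_image)
  then obtain M where "\<And>x. x \<in> {0..b} \<Longrightarrow> \<bar>p x\<bar> \<le> M"
    by (force dest!: compact_imp_bounded simp: bounded_iff)
  then show ?thesis by (intro that[of "max 0 M"]) fastforce+
qed

text \<open>Completion does not change the integral of a Borel function, and Fubini's theorem and
  affine substitution are used over \<open>lborel\<close>.\<close>

lemma laplace_conv_lborel:
  assumes [measurable]: "p \<in> borel_measurable borel" "q \<in> borel_measurable borel"
  shows "laplace_conv p q t = (\<integral>s. indicator {0..t} s * (p (t - s) * q s) \<partial>lborel)"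
  unfolding laplace_conv_def set_lebesgue_integral_def
  by (subst integral_completion) auto

text \<open>Moving the variable domain \<open>{0..t}\<close> into a conditional makes the integrand
  jointly measurable in \<open>t\<close> and \<open>s\<close>.\<close>

lemma laplace_conv_measurable [measurable]:
  assumes [measurable]: "p \<in> borel_measurable borel" "q \<in> borel_measurable borel"
  shows "laplace_conv p q \<in> borel_measurable borel"
proof -
  have "laplace_conv p q =
      (\<lambda>t. \<integral>s. (if 0 \<le> s \<and> s \<le> t then p (t - s) * q s else 0) \<partial>lborel)"
    by (rule ext, subst laplace_conv_lborel) (auto intro!: Bochner_Integration.integral_cong)
  also have "\<dots> \<in> borel_measurable borel"
    by measurable
  finally show ?thesis .
qed

text \<open>The endpoints form a null set. Agreement is asked only strictly inside because
  \<open>0 powr 0 = 0\<close> makes some kernels take an unwanted value at 0.\<close>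

lemma laplace_conv_cong:
  assumes [measurable]: "p \<in> borel_measurable borel" "q \<in> borel_measurable borel"
      "p' \<in> borel_measurable borel" "q' \<in> borel_measurable borel"
    and "\<And>s. 0 < s \<Longrightarrow> s < t \<Longrightarrow> p s = p' s" "\<And>s. 0 < s \<Longrightarrow> s < t \<Longrightarrow> q s = q' s"
  shows "laplace_conv p q t = laplace_conv p' q' t"
proof -
  have "AE s in lborel. s \<noteq> 0 \<and> s \<noteq> t"
    by (simp add: AE_lborel_singleton)
  then have "AE s in lborel. indicator {0..t} s * (p (t - s) * q s)
        = indicator {0..t} s * (p' (t - s) * q' s)"
    by eventually_elim (use assms in \<open>auto simp: indicator_def\<close>)
  then show ?thesis
    unfolding laplace_conv_lborel[OF assms(1,2)] laplace_conv_lborel[OF assms(3,4)]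
    by (intro integral_cong_AE) auto
qed

lemma laplace_conv_commute:
  assumes [measurable]: "p \<in> borel_measurable borel" "q \<in> borel_measurable borel"
  shows "laplace_conv p q t = laplace_conv q p t"
  unfolding laplace_conv_lborel[OF assms] laplace_conv_lborel[OF assms(2,1)]
  by (subst lborel_integral_real_affine[where c = "-1" and t = t])
     (auto intro!: Bochner_Integration.integral_cong simp: indicator_def)

text \<open>By translation invariance the inner integral of the norm is the L1 norm of
  \<open>q\<close> times \<open>\<bar>r x\<bar>\<close>, which is integrable in
  \<open>x\<close>.\<close>

lemma integrable_convolution_product:
  fixes q r :: "real \<Rightarrow> real"
  assumes q: "integrable lborel q" and r: "integrable lborel r"
  shows "integrable (lborel \<Otimes>\<^sub>M lborel) (\<lambda>(x, y). q (y - x) * r x)"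
proof -
  have [measurable]: "q \<in> borel_measurable borel" "r \<in> borel_measurable borel"
    using q r by auto
  have sh: "integrable lborel (\<lambda>y. q (y - x))" for x
    using lborel_integrable_real_affine[OF q, of 1 "-x"] by (simp add: algebra_simps)
  have eq: "(\<integral>y. norm (q (y - x) * r x) \<partial>lborel) = (\<integral>y. \<bar>q y\<bar> \<partial>lborel) * \<bar>r x\<bar>" for x
  proof -
    have "(\<integral>y. \<bar>q y\<bar> \<partial>lborel) = (\<integral>y. \<bar>q (y - x)\<bar> \<partial>lborel)"
      by (subst lborel_integral_real_affine[where c = 1 and t = "-x"]) (simp_all add: algebra_simps)
    then show ?thesis by (simp add: abs_mult)
  qed
  show ?thesis
  proof (rule lborel_pair.Fubini_integrable)
    show "integrable lborel (\<lambda>x. \<integral>y. norm (case (x, y) of (x, y) \<Rightarrow> q (y - x) * r x) \<partial>lborel)"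
      using r by (simp only: prod.case eq) simp
  qed (use sh in \<open>auto intro!: AE_I2 integrable_mult_left\<close>)
qed

lemma integrable_to_truncate:
  "integrable_to b p \<Longrightarrow> integrable lborel (\<lambda>s. indicator {0..b} s * p s)"
  by (simp add: integrable_to_def set_integrable_def)

lemma integrable_to_conv:
  assumes q: "integrable_to b q" and r: "integrable_to b r"
  shows "integrable_to b (laplace_conv q r)"
proof -
  note [measurable] = integrable_to_measurable[OF q] integrable_to_measurable[OF r]
  define Q where "Q = (\<lambda>s. indicator {0..b} s * q s)"
  define R where "R = (\<lambda>s. indicator {0..b} s * r s)"
  have "integrable (lborel \<Otimes>\<^sub>M lborel) (\<lambda>(x, y). Q (y - x) * R x)"
    unfolding Q_def R_def
    by (intro integrable_convolution_product integrable_to_truncate q r)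
  from lborel_pair.integrable_snd[OF this]
  have "set_integrable lborel {0..b} (\<lambda>y. \<integral>x. Q (y - x) * R x \<partial>lborel)"
    unfolding set_integrable_def by (intro integrable_mult_indicator) auto
  \<comment> \<open>For \<open>y\<close> in \<open>{0..b}\<close> the two truncations leave exactly
    the range \<open>0 \<le> x \<le> y\<close>, so the convolution over the line is the Laplace
    convolution.\<close>
  also have "?this \<longleftrightarrow> set_integrable lborel {0..b} (laplace_conv q r)"
    by (intro set_integrable_cong refl, subst laplace_conv_lborel)
       (auto intro!: Bochner_Integration.integral_cong simp: indicator_def Q_def R_def)
  finally show ?thesis by (simp add: integrable_to_def)
qed

lemma integrable_conv_integrand:
  assumes p: "kernel_on b p" and q: "integrable_to b q" and t: "t \<le> b"
  shows "integrable lborel (\<lambda>s. indicator {0..t} s * (p (t - s) * q s))"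
proof -
  note [measurable] = kernel_on_measurable[OF p] integrable_to_measurable[OF q]
  obtain M where M: "M \<ge> 0" "\<And>x. x \<in> {0..b} \<Longrightarrow> \<bar>p x\<bar> \<le> M"
    using kernel_on_bounded[OF p] by blast
  show ?thesis
  proof (rule Bochner_Integration.integrable_bound)
    show "integrable lborel (\<lambda>s. M * (indicator {0..b} s * q s))"
      using integrable_to_truncate[OF q] by (rule integrable_mult_right)
    show "AE s in lborel. norm (indicator {0..t} s * (p (t - s) * q s))
            \<le> norm (M * (indicator {0..b} s * q s))"
      using M t by (auto simp: indicator_def abs_mult intro!: mult_right_mono)
  qed auto
qed

text \<open>Fubini's theorem on the triangle \<open>0 \<le> x \<le> y \<le> t\<close>. The bound on
  the continuous factor \<open>p\<close> dominates the integrand by an integrable product, which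
  makes the identity hold at every \<open>t\<close> instead of almost every one.\<close>

lemma laplace_conv_assoc:
  assumes p: "kernel_on b p" and q: "integrable_to b q" and r: "integrable_to b r" and t: "t \<le> b"
  shows "laplace_conv p (laplace_conv q r) t = laplace_conv (laplace_conv p q) r t"
proof -
  note [measurable] = kernel_on_measurable[OF p] integrable_to_measurable[OF q]
    integrable_to_measurable[OF r]
  obtain M where M: "M \<ge> 0" "\<And>x. x \<in> {0..b} \<Longrightarrow> \<bar>p x\<bar> \<le> M"
    using kernel_on_bounded[OF p] by blast
  define F where "F x y = (if 0 \<le> x \<and> x \<le> y \<and> y \<le> t then p (t - y) * q (y - x) * r x else 0)" for x y
  have F_meas [measurable]: "(\<lambda>(x, y). F x y) \<in> borel_measurable (lborel \<Otimes>\<^sub>M lborel)"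
    unfolding F_def by measurable
  define Q where "Q = (\<lambda>s. indicator {0..b} s * q s)"
  define R where "R = (\<lambda>s. indicator {0..b} s * r s)"
  have "integrable (lborel \<Otimes>\<^sub>M lborel) (\<lambda>(x, y). F x y)"
  proof (rule Bochner_Integration.integrable_bound)
    show "integrable (lborel \<Otimes>\<^sub>M lborel) (\<lambda>z. M * (case z of (x, y) \<Rightarrow> Q (y - x) * R x))"
      unfolding Q_def R_def
      by (intro integrable_mult_right integrable_convolution_product integrable_to_truncate q r)
    show "AE z in lborel \<Otimes>\<^sub>M lborel. norm (case z of (x, y) \<Rightarrow> F x y)
        \<le> norm (M * (case z of (x, y) \<Rightarrow> Q (y - x) * R x))"
      using M t
      by (intro AE_I2)
         (auto simp: F_def Q_def R_def indicator_def abs_mult mult.assoc intro!: mult_right_mono)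
  qed auto
  note fub = lborel_pair.Fubini_integral[OF this]
  have "laplace_conv p (laplace_conv q r) t = (\<integral>y. (\<integral>x. F x y \<partial>lborel) \<partial>lborel)"
  proof (subst laplace_conv_lborel, simp, simp, intro Bochner_Integration.integral_cong refl)
    fix y
    have "indicator {0..t} y * (p (t - y) * laplace_conv q r y) =
        (\<integral>x. indicator {0..t} y * (p (t - y) * (indicator {0..y} x * (q (y - x) * r x))) \<partial>lborel)"
      by (subst laplace_conv_lborel) auto
    also have "\<dots> = (\<integral>x. F x y \<partial>lborel)"
      by (intro Bochner_Integration.integral_cong) (auto simp: F_def indicator_def)
    finally show "indicator {0..t} y * (p (t - y) * laplace_conv q r y) = (\<integral>x. F x y \<partial>lborel)" .
  qed
  moreover have "laplace_conv (laplace_conv p q) r t = (\<integral>x. (\<integral>y. F x y \<partial>lborel) \<partial>lborel)"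
  proof (subst laplace_conv_lborel, simp, simp, intro Bochner_Integration.integral_cong refl)
    fix x
    have "indicator {0..t} x * (laplace_conv p q (t - x) * r x) =
        (\<integral>y. indicator {0..t} x * ((indicator {0..t - x} y * (p (t - x - y) * q y)) * r x) \<partial>lborel)"
      by (subst laplace_conv_lborel) auto
    \<comment> \<open>The shape \<open>x + 1 * y\<close> is that of an affine substitution with
      slope 1, which the next step undoes.\<close>
    also have "\<dots> = (\<integral>y. F x (x + 1 * y) \<partial>lborel)"
      by (intro Bochner_Integration.integral_cong) (auto simp: F_def indicator_def algebra_simps)
    also have "\<dots> = (\<integral>y. F x y \<partial>lborel)"
      by (subst (2) lborel_integral_real_affine[where c = 1 and t = x]) auto
    finally show "indicator {0..t} x * (laplace_conv p q (t - x) * r x) = (\<integral>y. F x y \<partial>lborel)" .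
  qed
  ultimately show ?thesis using fub by simp
qed

lemma laplace_conv_linear_right:
  assumes p: "kernel_on b p" and q: "integrable_to b q" "integrable_to b r" and t: "t \<le> b"
  shows "laplace_conv p (\<lambda>s. x * q s + y * r s) t = x * laplace_conv p q t + y * laplace_conv p r t"
proof -
  note [measurable] = kernel_on_measurable[OF p] q[THEN integrable_to_measurable]
  have "laplace_conv p (\<lambda>s. x * q s + y * r s) t
      = (\<integral>s. x * (indicator {0..t} s * (p (t - s) * q s))
           + y * (indicator {0..t} s * (p (t - s) * r s)) \<partial>lborel)"
    by (subst laplace_conv_lborel)
       (auto intro!: Bochner_Integration.integral_cong simp: algebra_simps)
  then show ?thesis
    using integrable_conv_integrand[OF p q(1) t] integrable_conv_integrand[OF p q(2) t]
    by (simp add: laplace_conv_lborel)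
qed

lemma laplace_conv_diff_right:
  assumes "kernel_on b p" "integrable_to b q" "integrable_to b r" "t \<le> b"
  shows "laplace_conv p (\<lambda>s. q s - r s) t = laplace_conv p q t - laplace_conv p r t"
  using laplace_conv_linear_right[OF assms, of 1 "-1"] by simp

lemma laplace_conv_linear_left:
  assumes p: "kernel_on b p" "kernel_on b q" and r: "integrable_to b r" and t: "t \<le> b"
  shows "laplace_conv (\<lambda>s. x * p s + y * q s) r t = x * laplace_conv p r t + y * laplace_conv q r t"
proof -
  note [measurable] = p[THEN kernel_on_measurable] r[THEN integrable_to_measurable]
  have "laplace_conv (\<lambda>s. x * p s + y * q s) r t
      = (\<integral>s. x * (indicator {0..t} s * (p (t - s) * r s)) 
           + y * (indicator {0..t} s * (q (t - s) * r s)) \<partial>lborel)"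
    by (subst laplace_conv_lborel)
       (auto intro!: Bochner_Integration.integral_cong simp: algebra_simps)
  then show ?thesis
    using integrable_conv_integrand[OF p(1) r t] integrable_conv_integrand[OF p(2) r t]
    by (simp add: laplace_conv_lborel)
qed

lemma laplace_conv_scale_right:
  "laplace_conv p (\<lambda>s. c * q s) t = c * laplace_conv p q t"
  unfolding laplace_conv_def set_lebesgue_integral_def
  by (simp add: mult.left_commute flip: integral_mult_right_zero)

text \<open>Dominated convergence along sequences, with the bound of \<open>p\<close> times
  \<open>\<bar>q\<bar>\<close> as the dominating function.\<close>

lemma kernel_on_conv:
  assumes p: "kernel_on b p" and q: "integrable_to b q"
  shows "kernel_on b (laplace_conv p q)"
proof -
  note [measurable] = kernel_on_measurable[OF p] integrable_to_measurable[OF q]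
  obtain M where M: "M \<ge> 0" "\<And>x. x \<in> {0..b} \<Longrightarrow> \<bar>p x\<bar> \<le> M"
    using kernel_on_bounded[OF p] by blast
  have "(laplace_conv p q \<circ> X) \<longlonglongrightarrow> laplace_conv p q t"
    if X: "\<And>n. X n \<in> {0..b}" "X \<longlonglongrightarrow> t" and t: "t \<in> {0..b}" for X t
  proof -
    have "(\<lambda>n. \<integral>s. indicator {0..X n} s * (p (X n - s) * q s) \<partial>lborel)
        \<longlonglongrightarrow> (\<integral>s. indicator {0..t} s * (p (t - s) * q s) \<partial>lborel)"
    proof (rule integral_dominated_convergence)
      show "integrable lborel (\<lambda>s. M * \<bar>indicator {0..b} s * q s\<bar>)"
        using integrable_to_truncate[OF q] by (intro integrable_mult_right integrable_abs)
      show "AE s in lborel. norm (indicator {0..X n} s * (p (X n - s) * q s))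
          \<le> M * \<bar>indicator {0..b} s * q s\<bar>" for n
      proof (intro AE_I2)
        fix s show "norm (indicator {0..X n} s * (p (X n - s) * q s))
            \<le> M * \<bar>indicator {0..b} s * q s\<bar>"
          using M X(1)[of n] by (auto simp: indicator_def abs_mult intro!: mult_right_mono)
      qed
      \<comment> \<open>At \<open>s = t\<close> the indicator of \<open>{0..X n}\<close> need not
        converge, since \<open>X n\<close> may lie on either side of \<open>t\<close>.\<close>
      have "AE s in lborel. s \<noteq> t" by (rule AE_lborel_singleton)
      then show "AE s in lborel. (\<lambda>n. indicator {0..X n} s * (p (X n - s) * q s))
          \<longlonglongrightarrow> indicator {0..t} s * (p (t - s) * q s)"
      proof eventually_elim
        fix s assume "s \<noteq> t"
        consider "s < 0" | "s > t" | "0 \<le> s" "s < t" using \<open>s \<noteq> t\<close> by linarith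
        then show "(\<lambda>n. indicator {0..X n} s * (p (X n - s) * q s))
            \<longlonglongrightarrow> indicator {0..t} s * (p (t - s) * q s)"
        proof cases
          case 2
          have "eventually (\<lambda>n. indicator {0..X n} s * (p (X n - s) * q s) = 0) sequentially"
            using order_tendstoD(2)[OF X(2) 2] by eventually_elim auto
          then show ?thesis using 2 by (simp add: tendsto_eventually)
        next
          case 3
          have ev: "eventually (\<lambda>n. s < X n) sequentially"
            using order_tendstoD(1)[OF X(2) 3(2)] .
          have "(\<lambda>n. p (X n - s)) \<longlonglongrightarrow> p (t - s)"
          proof (rule continuous_on_tendsto_compose[of "{0..b}" p])
            show "continuous_on {0..b} p" using p by (simp add: kernel_on_def)
            show "(\<lambda>n. X n - s) \<longlonglongrightarrow> t - s" using X(2) by (intro tendsto_intros)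
            show "t - s \<in> {0..b}" using 3 t by auto
            show "\<forall>\<^sub>F n in sequentially. X n - s \<in> {0..b}"
            proof (use ev in eventually_elim)
              fix n assume "s < X n" then show "X n - s \<in> {0..b}" using X(1)[of n] 3 by auto
            qed
          qed
          then have "(\<lambda>n. p (X n - s) * q s) \<longlonglongrightarrow> p (t - s) * q s"
            by (intro tendsto_intros)
          moreover have "eventually (\<lambda>n. p (X n - s) * q s
              = indicator {0..X n} s * (p (X n - s) * q s)) sequentially"
            using ev by eventually_elim (use 3 in auto)
          ultimately have "(\<lambda>n. indicator {0..X n} s * (p (X n - s) * q s)) \<longlonglongrightarrow> p (t - s) * q s"
            by (rule Lim_transform_eventually)
          then show ?thesis using 3 by simp
        qed simp
      qed
    qed auto
    then show ?thesis by (simp add: laplace_conv_lborel o_def)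
  qed
  then show ?thesis
    by (auto simp: kernel_on_def continuous_on_sequentially)
qed

lemma laplace_conv_0:
  assumes [measurable]: "p \<in> borel_measurable borel" "q \<in> borel_measurable borel"
  shows "laplace_conv p q 0 = 0"
proof -
  have "AE s in lborel. s \<noteq> (0::real)" by (rule AE_lborel_singleton)
  then have "AE s in lborel. indicator {0..0} s * (p (0 - s) * q s) = 0"
    by eventually_elim auto
  then show ?thesis
    by (subst laplace_conv_lborel) (auto intro!: integral_eq_zero_AE)
qed

text \<open>\<open>d\<close> is the derivative of its own vanishing primitive; derivatives within
  \<open>{0..b}\<close> cover both endpoints. This is what strips an outer convolution with 1 from
  an identity.\<close>

lemma eq_0_if_integral_eq_0:
  assumes b: "0 < b" and d: "kernel_on b d"
    and z: "\<And>t. t \<in> {0..b} \<Longrightarrow> laplace_conv (\<lambda>_. 1) d t = 0" and t: "t \<in> {0..b}"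
  shows "d t = 0"
proof -
  note [measurable] = kernel_on_measurable[OF d]
  have "integral {0..x} d = 0" if x: "x \<in> {0..b}" for x
  proof -
    have "set_integrable lborel {0..x} d"
      by (rule set_integrable_subset[of lborel "{0..b}"])
         (use x kernel_on_integrable_to[OF d] in \<open>auto simp: integrable_to_def\<close>)
    from set_borel_integral_eq_integral(2)[OF this] z[OF x] show ?thesis
      by (simp add: laplace_conv_lborel set_lebesgue_integral_def)
  qed
  moreover have "((\<lambda>x. integral {0..x} d) has_vector_derivative d t) (at t within {0..b})"
    using d t by (intro integral_has_vector_derivative) (auto simp: kernel_on_def)
  ultimately have "((\<lambda>x. 0) has_vector_derivative d t) (at t within {0..b})"
    using t by (auto elim: has_vector_derivative_transform[rotated 2])
  moreover have "((\<lambda>x. 0) has_vector_derivative 0) (at t within {0..b})" by simp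
  ultimately show ?thesis
    using vector_derivative_unique_within_closed_interval[of 0 b t "\<lambda>_. 0" "d t" 0] b t by auto
qed

section \<open>Square integrable functions and Young's inequality\<close>

lemma abs_le_one_plus_square: "\<bar>x\<bar> \<le> 1 + x\<^sup>2" for x :: real
  using zero_le_power2[of "\<bar>x\<bar> - 1/2"] by (simp add: power2_eq_square algebra_simps)

definition square_integrable_to :: "real \<Rightarrow> (real \<Rightarrow> real) \<Rightarrow> bool" where
  "square_integrable_to b p \<longleftrightarrow>
     p \<in> borel_measurable borel \<and> set_integrable lborel {0..b} (\<lambda>s. (p s)\<^sup>2)"

lemma square_integrable_to_imp_integrable_to:
  assumes "square_integrable_to b p"
  shows "integrable_to b p"
proof -
  have [measurable]: "p \<in> borel_measurable borel"
    and sq: "set_integrable lborel {0..b} (\<lambda>s. (p s)\<^sup>2)"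
    using assms by (auto simp: square_integrable_to_def)
  have "set_integrable lborel {0..b} (\<lambda>s. 1 + (p s)\<^sup>2)"
    using sq borel_integrable_atLeastAtMost'[of 0 b "\<lambda>_. 1::real"] by (intro set_integral_add) auto
  then have "set_integrable lborel {0..b} p"
  proof (rule set_integrable_bound)
    show "AE x in lborel. x \<in> {0..b} \<longrightarrow> norm (p x) \<le> norm (1 + (p x)\<^sup>2)"
      using abs_le_one_plus_square by simp
  qed (auto simp: set_borel_measurable_def)
  then show ?thesis by (simp add: integrable_to_def)
qed

text \<open>Cauchy--Schwarz with the weight \<open>\<bar>q (t - \<cdot>)\<bar>\<close> reduces Young's inequality
  \<open>L\<^sup>1 * L\<^sup>2 \<subseteq> L\<^sup>2\<close> to \<open>L\<^sup>1 * L\<^sup>1 \<subseteq> L\<^sup>1\<close>.\<close>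

lemma square_integrable_to_conv:
  assumes q: "integrable_to b q" and p: "square_integrable_to b p"
  shows "square_integrable_to b (laplace_conv q p)"
proof -
  have p1: "integrable_to b p" by (rule square_integrable_to_imp_integrable_to[OF p])
  note [measurable] = integrable_to_measurable[OF q] integrable_to_measurable[OF p1]
  define Q where "Q = (\<lambda>s. \<bar>indicator {0..b} s * q s\<bar>)"
  define P where "P = (\<lambda>s. indicator {0..b} s * p s)"
  have Q: "integrable lborel Q"
    unfolding Q_def by (intro integrable_abs integrable_to_truncate q)
  have P2: "integrable lborel (\<lambda>s. (P s)\<^sup>2)"
  proof -
    have "(P s)\<^sup>2 = indicator {0..b} s *\<^sub>R (p s)\<^sup>2" for s by (simp add: P_def indicator_def)
    then show ?thesis using p by (simp add: square_integrable_to_def set_integrable_def)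
  qed
  have [measurable]: "Q \<in> borel_measurable borel" "P \<in> borel_measurable borel"
    by (auto simp: Q_def P_def)
  have Q0: "Q s \<ge> 0" for s by (simp add: Q_def)
  define A where "A = (\<integral>s. Q s \<partial>lborel)"
  have A0: "A \<ge> 0" unfolding A_def by (simp add: Q0)
  define H where "H = (\<lambda>t. \<integral>s. Q (t - s) * (P s)\<^sup>2 \<partial>lborel)"
  have prod: "integrable (lborel \<Otimes>\<^sub>M lborel) (\<lambda>(s, t). Q (t - s) * (P s)\<^sup>2)"
    by (rule integrable_convolution_product[OF Q P2])
  have H: "integrable lborel H"
    unfolding H_def by (rule lborel_pair.integrable_snd[OF prod])
  have QA: "integrable lborel (\<lambda>s. Q (t - s))" "(\<integral>s. Q (t - s) \<partial>lborel) = A" for t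
    using lborel_integrable_real_affine[OF Q, of "-1" t]
      lborel_integral_real_affine[where f = Q and c = "-1" and t = t]
    by (simp_all add: A_def)
  \<comment> \<open>\<open>H t\<close> bounds the square only where its integrand is integrable; at
    other points the integral defaults to 0. Integrability of the product gives this for almost
    every \<open>t\<close>.\<close>
  have "AE t in lborel. integrable lborel (\<lambda>s. Q (t - s) * (P s)\<^sup>2)"
    using lborel_pair.AE_integrable_snd[OF prod] by simp
  then have bnd: "AE t in lborel. t \<in> {0..b} \<longrightarrow> (laplace_conv q p t)\<^sup>2 \<le> A * H t"
  proof eventually_elim
    fix t assume int: "integrable lborel (\<lambda>s. Q (t - s) * (P s)\<^sup>2)"
    have H0: "H t \<ge> 0" unfolding H_def by (simp add: Q0)
    have "(laplace_conv q p t)\<^sup>2 \<le> A * H t" if t: "t \<in> {0..b}"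
    proof -
      have meas: "(\<lambda>s. indicator {0..t} s * (q (t - s) * p s)) \<in> borel_measurable lborel"
        by measurable
      have le: "\<bar>indicator {0..t} s * (q (t - s) * p s)\<bar> \<le> Q (t - s) * \<bar>P s\<bar>" for s
        using t by (auto simp: Q_def P_def indicator_def abs_mult)
      have le2: "Q (t - s) * \<bar>P s\<bar> \<le> Q (t - s) + Q (t - s) * (P s)\<^sup>2" for s
        using mult_left_mono[OF abs_le_one_plus_square Q0, of "t - s" "P s"] by (simp add: algebra_simps)
      have integ: "integrable lborel (\<lambda>s. indicator {0..t} s * (q (t - s) * p s))"
      proof (rule Bochner_Integration.integrable_bound[OF Bochner_Integration.integrable_add[OF QA(1)[of t] int] meas])
        show "AE s in lborel. norm (indicator {0..t} s * (q (t - s) * p s))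
            \<le> norm (Q (t - s) + Q (t - s) * (P s)\<^sup>2)"
        proof (intro AE_I2)
          fix s
          show "norm (indicator {0..t} s * (q (t - s) * p s)) \<le> norm (Q (t - s) + Q (t - s) * (P s)\<^sup>2)"
            using le[of s] le2[of s] unfolding real_norm_def by linarith
        qed
      qed
      have "ennreal \<bar>laplace_conv q p t\<bar>
          \<le> (\<integral>\<^sup>+s. ennreal \<bar>indicator {0..t} s * (q (t - s) * p s)\<bar> \<partial>lborel)"
        using integral_norm_bound_ennreal[OF integ] by (subst laplace_conv_lborel) auto
      \<comment> \<open>Splitting \<open>Q\<close> into two square roots prepares Cauchy-Schwarz:
        the squared factors integrate to \<open>A\<close> and \<open>H t\<close>.\<close>
      also have "\<dots> \<le> (\<integral>\<^sup>+s. ennreal (sqrt (Q (t - s))) * ennreal (sqrt (Q (t - s)) * \<bar>P s\<bar>) \<partial>lborel)"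
        using le by (intro nn_integral_mono)
          (simp add: Q0 real_sqrt_mult_self abs_mult flip: ennreal_mult mult.assoc)
      finally have "(ennreal \<bar>laplace_conv q p t\<bar>)\<^sup>2 \<le>
          (\<integral>\<^sup>+s. ennreal (sqrt (Q (t - s))) * ennreal (sqrt (Q (t - s)) * \<bar>P s\<bar>) \<partial>lborel)\<^sup>2"
        by (rule power_mono) simp
      also have "\<dots> \<le> (\<integral>\<^sup>+s. (ennreal (sqrt (Q (t - s))))\<^sup>2 \<partial>lborel)
          * (\<integral>\<^sup>+s. (ennreal (sqrt (Q (t - s)) * \<bar>P s\<bar>))\<^sup>2 \<partial>lborel)"
        by (rule Cauchy_Schwarz_nn_integral) auto
      also have "\<dots> = (\<integral>\<^sup>+s. ennreal (Q (t - s)) \<partial>lborel) * (\<integral>\<^sup>+s. ennreal (Q (t - s) * (P s)\<^sup>2) \<partial>lborel)"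
        by (simp add: ennreal_power Q0 power_mult_distrib)
      also have "\<dots> = ennreal A * ennreal (H t)"
        unfolding H_def using QA[of t] int
        by (simp add: nn_integral_eq_integral Q0)
      finally show ?thesis
        using A0 H0 by (simp add: ennreal_power ennreal_mult[symmetric])
    qed
    then show "t \<in> {0..b} \<longrightarrow> (laplace_conv q p t)\<^sup>2 \<le> A * H t" by blast
  qed
  have "set_integrable lborel {0..b} (\<lambda>t. (laplace_conv q p t)\<^sup>2)"
    unfolding set_integrable_def
  proof (rule Bochner_Integration.integrable_bound)
    show "integrable lborel (\<lambda>t. A * H t)" using H by (rule integrable_mult_right)
    show "AE t in lborel. norm (indicator {0..b} t *\<^sub>R (laplace_conv q p t)\<^sup>2) \<le> norm (A * H t)"
      using bnd by eventually_elim (auto simp: indicator_def)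
  qed auto
  then show ?thesis by (simp add: square_integrable_to_def)
qed

lemma square_integrable_to_add:
  assumes p: "square_integrable_to b p" and q: "square_integrable_to b q"
  shows "square_integrable_to b (\<lambda>s. x * p s + y * q s)"
proof -
  have [measurable]: "p \<in> borel_measurable borel" "q \<in> borel_measurable borel"
    using p q by (auto simp: square_integrable_to_def)
  have "set_integrable lborel {0..b} (\<lambda>s. 2 * x\<^sup>2 * (p s)\<^sup>2 + 2 * y\<^sup>2 * (q s)\<^sup>2)"
    using p q by (intro set_integral_add set_integrable_mult_right)
      (auto simp: square_integrable_to_def)
  then have "set_integrable lborel {0..b} (\<lambda>s. (x * p s + y * q s)\<^sup>2)"
  proof (rule set_integrable_bound)
    have "(x * v + y * w)\<^sup>2 \<le> 2 * x\<^sup>2 * v\<^sup>2 + 2 * y\<^sup>2 * w\<^sup>2" for v w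
      using zero_le_power2[of "x * v - y * w"] by (simp add: power2_eq_square algebra_simps)
    then show "AE s in lborel. s \<in> {0..b} \<longrightarrow>
        norm ((x * p s + y * q s)\<^sup>2) \<le> norm (2 * x\<^sup>2 * (p s)\<^sup>2 + 2 * y\<^sup>2 * (q s)\<^sup>2)" by auto
  qed (auto simp: set_borel_measurable_def)
  then show ?thesis by (simp add: square_integrable_to_def)
qed

section \<open>Weak derivatives on an interval\<close>

text \<open>Weak derivatives are only Lebesgue measurable, while the convolution calculus is Borel;
  changing \<open>w\<close> on a null set connects the two.\<close>

lemma square_integrable_on_borel_representative:
  assumes "square_integrable_on w {0<..<b}"
  obtains p where "square_integrable_to b p" "AE x in lebesgue. x \<in> {0<..<b} \<longrightarrow> w x = p x"
proof -
  have "(\<lambda>x. indicator {0<..<b} x * w x) \<in> borel_measurable lebesgue"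
    and sq: "integrable lebesgue (\<lambda>x. indicator {0<..<b} x * (w x)\<^sup>2)"
    using assms by (auto simp: square_integrable_on_def set_borel_measurable_def set_integrable_def)
  then obtain p where [measurable]: "p \<in> borel_measurable borel"
    and "AE x in lborel. indicator {0<..<b} x * w x = p x"
    using completion_ex_borel_measurable_real by fastforce
  then have ae: "AE x in lebesgue. indicator {0<..<b} x * w x = p x"
    by (intro AE_completion)
  have "integrable lebesgue (\<lambda>x. (p x)\<^sup>2)"
  proof (rule integrable_cong_AE_imp[OF sq])
    show "AE x in lebesgue. indicator {0<..<b} x * (w x)\<^sup>2 = (p x)\<^sup>2"
      using ae by eventually_elim (auto simp: indicator_def split: if_splits)
  qed (auto intro!: measurable_completion)
  then have "integrable lborel (\<lambda>x. (p x)\<^sup>2)"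
    by (subst (asm) integrable_completion) auto
  then have "set_integrable lborel {0..b} (\<lambda>x. (p x)\<^sup>2)"
    unfolding set_integrable_def by (intro integrable_mult_indicator) auto
  then have "square_integrable_to b p" by (simp add: square_integrable_to_def)
  moreover have "AE x in lebesgue. x \<in> {0<..<b} \<longrightarrow> w x = p x"
    using ae by eventually_elim auto
  ultimately show thesis by (rule that)
qed

text \<open>Completeness of the measure transfers measurability from \<open>f\<close> to
  \<open>g\<close>, so nothing has to be known about \<open>g\<close> beforehand.\<close>

lemma lebesgue_integral_cong_AE:
  fixes f g :: "real \<Rightarrow> real"
  assumes "f \<in> borel_measurable lebesgue" "AE x in lebesgue. f x = g x"
  shows "integral\<^sup>L lebesgue g = integral\<^sup>L lebesgue f"
  using assms by (intro integral_cong_AE) (auto intro: borel_measurable_AE)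

lemma laplace_conv_cong_AE:
  assumes ae: "AE x in lebesgue. x \<in> {0<..<b} \<longrightarrow> w x = p x"
    and [measurable]: "k \<in> borel_measurable borel" "p \<in> borel_measurable borel" and t: "t \<le> b"
  shows "laplace_conv k w t = laplace_conv k p t"
  unfolding laplace_conv_def set_lebesgue_integral_def
proof (rule lebesgue_integral_cong_AE)
  have "AE s in lborel. s \<noteq> 0 \<and> s \<noteq> t" by (simp add: AE_lborel_singleton)
  then have "AE s in lebesgue. s \<noteq> 0 \<and> s \<noteq> t" by (rule AE_completion)
  with ae show "AE s in lebesgue. indicator {0..t} s *\<^sub>R (k (t - s) * p s)
      = indicator {0..t} s *\<^sub>R (k (t - s) * w s)"
    by eventually_elim (use t in \<open>auto simp: indicator_def\<close>)
qed (intro measurable_completion, measurable)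

section \<open>Test functions and integration by parts\<close>

lemma test_functionsD:
  assumes phi: "\<phi> \<in> test_functions {0<..<b}"
  shows "(\<phi> has_real_derivative deriv \<phi> x) (at x)" "continuous_on A (deriv \<phi>)"
    "\<phi> 0 = 0" "\<phi> b = 0"
proof -
  from phi obtain D where D: "\<And>x. (\<phi> has_vector_derivative D x) (at x)" "continuous_on UNIV D"
    by (auto simp: test_functions_def C1_differentiable_on_def)
  then have "(\<phi> has_real_derivative D x) (at x)" for x
    by (simp add: has_real_derivative_iff_has_vector_derivative)
  then have *: "deriv \<phi> = D" by (auto intro: DERIV_imp_deriv)
  show "(\<phi> has_real_derivative deriv \<phi> x) (at x)" "continuous_on A (deriv \<phi>)"
    using D by (auto simp: * has_real_derivative_iff_has_vector_derivative intro: continuous_on_subset)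
  have "{x. \<phi> x \<noteq> 0} \<subseteq> {0<..<b}"
    using phi closure_subset[of "{x. \<phi> x \<noteq> 0}"] by (auto simp: test_functions_def)
  then show "\<phi> 0 = 0" "\<phi> b = 0" by auto
qed

lemma integral_open_lebesgue_continuous:
  assumes "continuous_on {0..b} (f :: real \<Rightarrow> real)"
  shows "(LINT x:{0<..<b}|lebesgue. f x) = integral {0..b} f"
proof -
  have "set_integrable lebesgue {0..b} f"
    using assms absolutely_integrable_continuous_real by blast
  then have "set_integrable lebesgue {0<..<b} f"
    by (rule set_integrable_subset) auto
  from set_lebesgue_integral_eq_integral(2)[OF this] show ?thesis
    by (simp add: integral_open_interval_real)
qed

text \<open>Integration by parts is associativity of the convolution, evaluated at \<open>b\<close>, for the
  reflected kernel \<open>\<phi>' (b - \<cdot>)\<close>.\<close>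

lemma integral_primitive_test_function:
  assumes b: "0 < b" and p: "integrable_to b p" and phi: "\<phi> \<in> test_functions {0<..<b}"
  shows "integral {0..b} (\<lambda>x. laplace_conv (\<lambda>_. 1) p x * deriv \<phi> x)
    = - (LINT x:{0<..<b}|lebesgue. p x * \<phi> x)"
proof -
  note d = test_functionsD[OF phi]
  have contphi: "continuous_on A \<phi>" for A
    using d(1) by (meson DERIV_isCont continuous_at_imp_continuous_on)
  note [measurable] = integrable_to_measurable[OF p]
  have [measurable]: "\<phi> \<in> borel_measurable borel" "deriv \<phi> \<in> borel_measurable borel"
    using contphi d(2) by (auto intro!: borel_measurable_continuous_onI)
  define \<psi> where "\<psi> = (\<lambda>s. deriv \<phi> (b - s))"
  have psi: "kernel_on b \<psi>"
    unfolding kernel_on_def \<psi>_def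
    by (intro conjI continuous_on_compose2[OF d(2)[of UNIV]] continuous_intros) auto
  have one: "kernel_on b (\<lambda>_. 1)" by (simp add: kernel_on_def)
  note [measurable] = kernel_on_measurable[OF psi]
  have P: "kernel_on b (laplace_conv (\<lambda>_. 1) p)"
    by (rule kernel_on_conv[OF one p])
  have psi1: "laplace_conv \<psi> (\<lambda>_. 1) t = - \<phi> (b - t)" if t: "t \<in> {0..b}" for t
  proof -
    have "((\<lambda>s. - \<phi> (b - s)) has_real_derivative \<psi> s) (at s within {0..t})" for s
    proof -
      have "((\<lambda>s. b - s) has_real_derivative -1) (at s)"
        by (auto intro!: derivative_eq_intros)
      from DERIV_minus[OF DERIV_chain2[OF d(1) this]] show ?thesis
        by (simp add: \<psi>_def has_field_derivative_at_within)
    qed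
    then have "(\<psi> has_integral (- \<phi> (b - t) - (- \<phi> (b - 0)))) {0..t}"
      using t by (intro fundamental_theorem_of_calculus)
        (simp_all flip: has_real_derivative_iff_has_vector_derivative)
    then have "integral {0..t} \<psi> = - \<phi> (b - t)"
      using d(4) by (simp add: integral_unique)
    moreover have "set_integrable lborel {0..t} \<psi>"
    proof (rule borel_integrable_atLeastAtMost', rule continuous_on_subset)
      show "continuous_on {0..b} \<psi>" using psi by (simp add: kernel_on_def)
    qed (use t in auto)
    ultimately have "laplace_conv (\<lambda>_. 1) \<psi> t = - \<phi> (b - t)"
      using set_borel_integral_eq_integral(2)[of "{0..t}" \<psi>]
      by (simp add: laplace_conv_lborel set_lebesgue_integral_def)
    then show ?thesis
      by (subst laplace_conv_commute) auto
  qed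
  have cont: "continuous_on {0..b} (\<lambda>x. laplace_conv (\<lambda>_. 1) p x * deriv \<phi> x)"
    using P by (auto simp: kernel_on_def intro!: continuous_intros d(2))
  have "integral {0..b} (\<lambda>x. laplace_conv (\<lambda>_. 1) p x * deriv \<phi> x)
      = (LINT x:{0..b}|lborel. laplace_conv (\<lambda>_. 1) p x * deriv \<phi> x)"
    using cont borel_integrable_atLeastAtMost'[OF cont]
    by (intro set_borel_integral_eq_integral(2)[symmetric])
  also have "\<dots> = laplace_conv \<psi> (laplace_conv (\<lambda>_. 1) p) b"
    by (subst laplace_conv_lborel)
       (auto simp: set_lebesgue_integral_def \<psi>_def mult.commute intro!: Bochner_Integration.integral_cong)
  also have "\<dots> = laplace_conv (laplace_conv \<psi> (\<lambda>_. 1)) p b"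
    by (rule laplace_conv_assoc[OF psi kernel_on_integrable_to[OF one] p]) simp
  also have "\<dots> = laplace_conv (\<lambda>t. - \<phi> (b - t)) p b"
    by (rule laplace_conv_cong) (auto intro!: psi1)
  also have "\<dots> = - (\<integral>x. indicator {0<..<b} x * (p x * \<phi> x) \<partial>lborel)"
  proof (subst laplace_conv_lborel, simp, simp, subst integral_minus[symmetric],
      intro Bochner_Integration.integral_cong refl)
    fix x
    \<comment> \<open>Passing from the closed to the open interval is exact at every point, because
      \<open>\<phi>\<close> vanishes at 0 and \<open>b\<close>.\<close>
    show "indicator {0..b} x * (- \<phi> (b - (b - x)) * p x) = - (indicator {0<..<b} x * (p x * \<phi> x))"
      using d(3,4) by (cases "x = 0 \<or> x = b") (auto simp: indicator_def)
  qed
  also have "\<dots> = - (LINT x:{0<..<b}|lebesgue. p x * \<phi> x)"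
    unfolding set_lebesgue_integral_def by (subst integral_completion) auto
  finally show ?thesis .
qed

text \<open>The constant contributes \<open>c * (\<phi> b - \<phi> 0) = 0\<close>, and the rest is
  integration by parts. With the converse \<open>H1C_primitive\<close>, the space
  \<open>H1C b\<close> consists exactly of the primitives of square integrable functions.\<close>

lemma primitive_has_L2_weak_derivative:
  assumes b: "0 < b" and p: "square_integrable_to b p"
    and u: "\<And>t. t \<in> {0..b} \<Longrightarrow> u t = c + laplace_conv (\<lambda>_. 1) p t"
  shows "has_L2_weak_derivative_on u p {0<..<b}" "continuous_on {0..b} u"
proof -
  have p1: "integrable_to b p" by (rule square_integrable_to_imp_integrable_to[OF p])
  note [measurable] = integrable_to_measurable[OF p1]
  have one: "kernel_on b (\<lambda>_. 1)" by (simp add: kernel_on_def)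
  have P: "continuous_on {0..b} (laplace_conv (\<lambda>_. 1) p)"
    using kernel_on_conv[OF one p1] by (simp add: kernel_on_def)
  have "continuous_on {0..b} (\<lambda>t. c + laplace_conv (\<lambda>_. 1) p t)"
    using P by (intro continuous_intros)
  then show cu: "continuous_on {0..b} u"
    by (rule continuous_on_eq) (simp add: u)
  have "set_borel_measurable lebesgue {0<..<b} u"
  proof -
    have "continuous_on {0<..<b} u" by (rule continuous_on_subset[OF cu]) auto
    then have "(\<lambda>x. indicator {0<..<b} x *\<^sub>R u x) \<in> borel_measurable borel"
      by (intro borel_measurable_continuous_on_indicator) auto
    then show ?thesis unfolding set_borel_measurable_def by (intro measurable_completion) simp
  qed
  moreover have "set_integrable lebesgue {0..b} (\<lambda>x. (u x)\<^sup>2)"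
    by (intro absolutely_integrable_continuous_real continuous_intros cu)
  then have "set_integrable lebesgue {0<..<b} (\<lambda>x. (u x)\<^sup>2)"
    by (rule set_integrable_subset) auto
  ultimately have "square_integrable_on u {0<..<b}" by (simp add: square_integrable_on_def)
  moreover have "square_integrable_on p {0<..<b}"
  proof -
    have "set_integrable lborel {0<..<b} (\<lambda>s. (p s)\<^sup>2)"
      by (rule set_integrable_subset[of lborel "{0..b}"])
         (use p in \<open>auto simp: square_integrable_to_def\<close>)
    then have "set_integrable lebesgue {0<..<b} (\<lambda>s. (p s)\<^sup>2)"
      unfolding set_integrable_def by (subst integrable_completion) auto
    then show ?thesis
      unfolding square_integrable_on_def set_borel_measurable_def
      by (auto intro!: measurable_completion)
  qed
  moreover have "(LINT x:{0<..<b}|lebesgue. u x * deriv \<phi> x)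
      = - (LINT x:{0<..<b}|lebesgue. p x * \<phi> x)" if phi: "\<phi> \<in> test_functions {0<..<b}" for \<phi>
  proof -
    note d = test_functionsD[OF phi]
    have "(deriv \<phi> has_integral \<phi> b - \<phi> 0) {0..b}"
      using b by (intro fundamental_theorem_of_calculus)
        (simp_all add: d(1) has_field_derivative_at_within
          flip: has_real_derivative_iff_has_vector_derivative)
    then have "((\<lambda>x. c * deriv \<phi> x) has_integral 0) {0..b}"
      using d(3,4) has_integral_mult_right[of "deriv \<phi>" 0 "{0..b}" c] by simp
    moreover have "(\<lambda>x. laplace_conv (\<lambda>_. 1) p x * deriv \<phi> x) integrable_on {0..b}"
      by (intro integrable_continuous_real continuous_intros P d(2))
    moreover have "(LINT x:{0<..<b}|lebesgue. u x * deriv \<phi> x) = integral {0..b} (\<lambda>x. u x * deriv \<phi> x)"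
      by (intro integral_open_lebesgue_continuous continuous_intros cu d(2))
    moreover have "integral {0..b} (\<lambda>x. u x * deriv \<phi> x)
        = integral {0..b} (\<lambda>x. c * deriv \<phi> x + laplace_conv (\<lambda>_. 1) p x * deriv \<phi> x)"
      by (intro integral_cong) (simp add: u algebra_simps)
    ultimately show ?thesis
      using integral_primitive_test_function[OF b p1 phi]
      by (simp add: integral_add has_integral_integrable integral_unique del: integral_mult_right)
  qed
  ultimately show "has_L2_weak_derivative_on u p {0<..<b}"
    by (simp add: has_L2_weak_derivative_on_def)
qed

text \<open>The test function is a primitive of \<open>\<eta> (v - c)\<close>, where \<open>\<eta>\<close> is a bump on \<open>[\<delta>, b - \<delta>]\<close> and
  \<open>c\<close> the \<open>\<eta>\<close>-mean of \<open>v\<close>; testing with it gives \<open>\<integral> \<eta> (v - c)\<^sup>2 = 0\<close>.\<close>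

lemma constant_on_inner_interval:
  fixes v :: "real \<Rightarrow> real"
  assumes v: "continuous_on {0..b} v" and \<delta>: "0 < \<delta>" "2 * \<delta> < b"
    and z: "\<And>\<phi>. \<phi> \<in> test_functions {0<..<b} \<Longrightarrow> integral {0..b} (\<lambda>x. v x * deriv \<phi> x) = 0"
  shows "\<exists>c. \<forall>x\<in>{\<delta><..<b - \<delta>}. v x = c"
proof -
  have b: "0 < b" using \<delta> by simp
  \<comment> \<open>The positive part of a parabola is merely continuous, which suffices: the test
    function is one integration smoother, hence C1.\<close>
  define \<eta> where "\<eta> x = max 0 ((x - \<delta>) * (b - \<delta> - x))" for x
  have eta_cont: "continuous_on A \<eta>" for A unfolding \<eta>_def by (intro continuous_intros)
  have eta_nonneg: "\<eta> x \<ge> 0" for x by (simp add: \<eta>_def)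
  have eta_pos: "\<eta> x > 0" if "\<delta> < x" "x < b - \<delta>" for x using that by (simp add: \<eta>_def)
  have eta_0: "\<eta> x = 0" if "x \<le> \<delta> \<or> b - \<delta> \<le> x" for x
  proof -
    have "(x - \<delta>) * (b - \<delta> - x) \<le> 0"
      using that \<delta> by (auto intro: mult_nonpos_nonneg mult_nonneg_nonpos)
    then show ?thesis by (simp add: \<eta>_def)
  qed
  have eta_int: "integral {0..b} \<eta> \<noteq> 0"
  proof
    assume "integral {0..b} \<eta> = 0"
    then have "\<eta> (b/2) = 0"
      using integral_eq_0_iff[of 0 b \<eta>] eta_cont b eta_nonneg by auto
    then show False using eta_pos[of "b/2"] \<delta> by simp
  qed
  define c where "c = integral {0..b} (\<lambda>x. \<eta> x * v x) / integral {0..b} \<eta>"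
  \<comment> \<open>Clamping the argument extends \<open>v\<close> continuously past
    \<open>{0..b}\<close>, so that \<open>\<psi>\<close> is continuous on the line and has a C1
    antiderivative there.\<close>
  define \<psi> where "\<psi> x = \<eta> x * (v (max 0 (min b x)) - c)" for x
  have psi_cont: "continuous_on A \<psi>" for A
    unfolding \<psi>_def using b
    by (intro continuous_intros eta_cont continuous_on_compose2[OF v]) auto
  have psi_eq: "\<psi> x = \<eta> x * (v x - c)" if "x \<in> {0..b}" for x using that by (simp add: \<psi>_def)
  have psi_int: "integral {0..b} \<psi> = 0"
  proof -
    have "integral {0..b} \<psi> = integral {0..b} (\<lambda>x. \<eta> x * v x - c * \<eta> x)"
      by (intro integral_cong) (simp add: psi_eq algebra_simps)
    also have "\<dots> = integral {0..b} (\<lambda>x. \<eta> x * v x) - c * integral {0..b} \<eta>"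
      by (subst integral_diff) (auto intro!: integrable_continuous_real continuous_intros v eta_cont)
    also have "\<dots> = 0" using eta_int by (simp add: c_def)
    finally show ?thesis .
  qed
  obtain F where F: "\<And>x. (F has_vector_derivative \<psi> x) (at x)"
    using einterval_antiderivative[of "-\<infinity>" "\<infinity>" \<psi>] psi_cont[of UNIV]
    by (auto simp: continuous_on_eq_continuous_at)
  have F_low: "F x = F 0" if "x \<le> \<delta>" for x
  proof -
    have "(F has_vector_derivative 0) (at y within {..\<delta>})" if "y \<in> {..\<delta>}" for y
      using has_vector_derivative_at_within[OF F[of y]] eta_0[of y] that by (simp add: \<psi>_def)
    then obtain C where "\<And>y. y \<in> {..\<delta>} \<Longrightarrow> F y = C"
      using has_vector_derivative_zero_constant[of "{..\<delta>}" F] convex_real_interval(2) by blast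
    then show ?thesis using that \<delta> by simp
  qed
  \<comment> \<open>The choice of \<open>c\<close> makes the mean of \<open>\<psi>\<close> zero, so
    \<open>F\<close> returns to its initial value and \<open>F - F 0\<close> has compact
    support.\<close>
  have F_b: "F b = F 0"
  proof -
    have "(\<psi> has_integral F b - F 0) {0..b}"
      using b F by (intro fundamental_theorem_of_calculus) (auto intro: has_vector_derivative_at_within)
    then show ?thesis using psi_int by (simp add: integral_unique)
  qed
  have F_high: "F x = F 0" if "b - \<delta> \<le> x" for x
  proof -
    have "(F has_vector_derivative 0) (at y within {b - \<delta>..})" if "y \<in> {b - \<delta>..}" for y
      using has_vector_derivative_at_within[OF F[of y]] eta_0[of y] that by (simp add: \<psi>_def)
    then obtain C where "\<And>y. y \<in> {b - \<delta>..} \<Longrightarrow> F y = C"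
      using has_vector_derivative_zero_constant[of "{b - \<delta>..}" F] convex_real_interval(1) by blast
    then have "F x = F b" using that \<delta> by simp
    then show ?thesis using F_b by simp
  qed
  define \<phi> where "\<phi> x = F x - F 0" for x
  have phi_deriv: "(\<phi> has_vector_derivative \<psi> x) (at x)" for x
    unfolding \<phi>_def using F by (auto intro!: derivative_eq_intros)
  then have deriv_phi: "deriv \<phi> = \<psi>"
    by (auto intro!: DERIV_imp_deriv simp: has_real_derivative_iff_has_vector_derivative)
  have "{x. \<phi> x \<noteq> 0} \<subseteq> {\<delta>..b - \<delta>}"
  proof (rule subsetI, rule ccontr)
    fix x assume "x \<in> {x. \<phi> x \<noteq> 0}" "x \<notin> {\<delta>..b - \<delta>}"
    then show False using F_low[of x] F_high[of x] by (auto simp: \<phi>_def not_le)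
  qed
  then have supp: "closure {x. \<phi> x \<noteq> 0} \<subseteq> {\<delta>..b - \<delta>}"
    by (rule closure_minimal) simp
  then have "compact (closure {x. \<phi> x \<noteq> 0})"
    using compact_Int_closed[of "{\<delta>..b - \<delta>}" "closure {x. \<phi> x \<noteq> 0}"] by (simp add: inf.absorb2)
  moreover have "closure {x. \<phi> x \<noteq> 0} \<subseteq> {0<..<b}" using supp \<delta> by fastforce
  moreover have "\<phi> C1_differentiable_on UNIV"
    using phi_deriv psi_cont by (auto simp: C1_differentiable_on_def)
  ultimately have "\<phi> \<in> test_functions {0<..<b}"
    by (simp add: test_functions_def)
  from z[OF this] have "integral {0..b} (\<lambda>x. v x * \<psi> x) = 0" by (simp add: deriv_phi)
  \<comment> \<open>The square equals \<open>(v - c) * \<psi>\<close>, and the part with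
    \<open>c\<close> integrates to 0.\<close>
  moreover have "integral {0..b} (\<lambda>x. \<eta> x * (v x - c)\<^sup>2)
      = integral {0..b} (\<lambda>x. v x * \<psi> x - c * \<psi> x)"
    by (intro integral_cong) (simp add: psi_eq power2_eq_square algebra_simps)
  moreover have "\<dots> = integral {0..b} (\<lambda>x. v x * \<psi> x) - c * integral {0..b} \<psi>"
    by (subst integral_diff) (auto intro!: integrable_continuous_real continuous_intros v psi_cont)
  ultimately have "integral {0..b} (\<lambda>x. \<eta> x * (v x - c)\<^sup>2) = 0" by (simp add: psi_int)
  then have *: "\<forall>x\<in>{0..b}. \<eta> x * (v x - c)\<^sup>2 = 0"
    by (subst (asm) integral_eq_0_iff) (auto intro!: continuous_intros mult_nonneg_nonneg v eta_cont eta_nonneg b)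
  have "v x = c" if "x \<in> {\<delta><..<b - \<delta>}" for x
    using bspec[OF *, of x] eta_pos[of x] that \<delta> by auto
  then show ?thesis by blast
qed

text \<open>The lemma of du Bois-Reymond for continuous functions. All inner intervals used contain
  the midpoint, so their constants agree; continuity reaches the endpoints.\<close>

lemma constant_if_weak_derivative_0:
  fixes v :: "real \<Rightarrow> real"
  assumes b: "0 < b" and v: "continuous_on {0..b} v"
    and z: "\<And>\<phi>. \<phi> \<in> test_functions {0<..<b} \<Longrightarrow> integral {0..b} (\<lambda>x. v x * deriv \<phi> x) = 0"
    and t: "t \<in> {0..b}"
  shows "v t = v 0"
proof -
  have "v x = v (b/2)" if x: "x \<in> {0<..<b}" for x
  proof -
    \<comment> \<open>Half the distance from \<open>x\<close> to the boundary; it is at most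
      \<open>b/4\<close>, so both \<open>x\<close> and the midpoint lie inside.\<close>
    define \<delta> where "\<delta> = min x (b - x) / 2"
    have "0 < \<delta>" "2 * \<delta> < b" "x \<in> {\<delta><..<b - \<delta>}" "b/2 \<in> {\<delta><..<b - \<delta>}"
      using x by (auto simp: \<delta>_def min_def field_simps)
    then show ?thesis using constant_on_inner_interval[OF v _ _ z] by metis
  qed
  then have *: "v x = v (b/2)" if "x \<in> {0..b}" for x
    using continuous_constant_on_closure[of "{0<..<b}" v "v (b/2)" x] that b v
    by (metis closure_greaterThanLessThan)
  show ?thesis using *[OF t] *[of 0] b by simp
qed

text \<open>\<open>u\<close> and the primitive of a Borel representative of its weak derivative have
  the same weak derivative, hence differ by a constant. The conclusion ties \<open>p\<close> to the
  very representative that enters \<open>ABC_derivative\<close>.\<close>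

lemma H1C_primitive:
  assumes b: "0 < b" and u: "u \<in> H1C b"
  obtains p where "square_integrable_to b p"
    "AE x in lebesgue. x \<in> {0<..<b} \<longrightarrow> weak_derivative {0<..<b} u x = p x"
    "\<And>t. t \<in> {0..b} \<Longrightarrow> u t = u 0 + laplace_conv (\<lambda>_. 1) p t"
proof -
  define w where "w = weak_derivative {0<..<b} u"
  have cu: "continuous_on {0..b} u" using u by (simp add: H1C_def)
  have "\<exists>w. has_L2_weak_derivative_on u w {0<..<b}"
    using u by (simp add: H1C_def H1_def)
  then have w: "has_L2_weak_derivative_on u w {0<..<b}"
    unfolding w_def weak_derivative_def by (rule someI_ex)
  then obtain p where p: "square_integrable_to b p"
    and ae: "AE x in lebesgue. x \<in> {0<..<b} \<longrightarrow> w x = p x"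
    using square_integrable_on_borel_representative by (auto simp: has_L2_weak_derivative_on_def)
  have p1: "integrable_to b p" by (rule square_integrable_to_imp_integrable_to[OF p])
  note [measurable] = integrable_to_measurable[OF p1]
  have one: "kernel_on b (\<lambda>_. 1)" by (simp add: kernel_on_def)
  define P where "P = laplace_conv (\<lambda>_. 1) p"
  have P: "continuous_on {0..b} P"
    using kernel_on_conv[OF one p1] by (simp add: kernel_on_def P_def)
  have "u t - P t = u 0 - P 0" if "t \<in> {0..b}" for t
  proof (rule constant_if_weak_derivative_0[OF b _ _ that])
    show "continuous_on {0..b} (\<lambda>t. u t - P t)" by (intro continuous_intros cu P)
    fix \<phi> assume phi: "\<phi> \<in> test_functions {0<..<b}"
    note d = test_functionsD[OF phi]
    have [measurable]: "\<phi> \<in> borel_measurable borel"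
      using d(1) by (intro borel_measurable_continuous_onI) (meson DERIV_isCont continuous_at_imp_continuous_on)
    have "integral {0..b} (\<lambda>x. u x * deriv \<phi> x) = (LINT x:{0<..<b}|lebesgue. u x * deriv \<phi> x)"
      by (intro integral_open_lebesgue_continuous[symmetric] continuous_intros cu d(2))
    also have "\<dots> = - (LINT x:{0<..<b}|lebesgue. w x * \<phi> x)"
      using w phi by (simp add: has_L2_weak_derivative_on_def)
    also have "(LINT x:{0<..<b}|lebesgue. w x * \<phi> x) = (LINT x:{0<..<b}|lebesgue. p x * \<phi> x)"
      unfolding set_lebesgue_integral_def
    proof (rule lebesgue_integral_cong_AE)
      show "AE x in lebesgue. indicator {0<..<b} x *\<^sub>R (p x * \<phi> x) = indicator {0<..<b} x *\<^sub>R (w x * \<phi> x)"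
        using ae by eventually_elim (auto simp: indicator_def)
    qed (intro measurable_completion, measurable)
    also have "- \<dots> = integral {0..b} (\<lambda>x. P x * deriv \<phi> x)"
      unfolding P_def by (rule integral_primitive_test_function[OF b p1 phi, symmetric])
    finally have "integral {0..b} (\<lambda>x. u x * deriv \<phi> x) = integral {0..b} (\<lambda>x. P x * deriv \<phi> x)" .
    then show "integral {0..b} (\<lambda>x. (u x - P x) * deriv \<phi> x) = 0"
      unfolding left_diff_distrib
      by (subst integral_diff) (auto intro!: integrable_continuous_real continuous_intros cu P d(2))
  qed
  moreover have "P 0 = 0" by (simp add: P_def laplace_conv_0)
  ultimately have "\<And>t. t \<in> {0..b} \<Longrightarrow> u t = u 0 + P t" by fastforce
  with p ae show thesis unfolding w_def P_def by (rule that)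
qed

section \<open>Mittag-Leffler functions\<close>

text \<open>Only the part of the Gamma integral over \<open>{c..c + 1}\<close> is kept. As
  \<open>c\<close> is free, Gamma outgrows every geometric sequence.\<close>

lemma Gamma_real_lower_bound:
  fixes c x :: real
  assumes c: "c \<ge> 1" and x: "x \<ge> 1"
  shows "c powr (x - 1) * exp (- (c + 1)) \<le> Gamma x"
proof -
  have "ennreal (c powr (x - 1) * exp (- (c + 1)))
      = (\<integral>\<^sup>+t. ennreal (c powr (x - 1) * exp (- (c + 1))) * indicator {c..c + 1} t \<partial>lborel)"
    by (subst nn_integral_cmult_indicator) auto
  also have "\<dots> \<le> (\<integral>\<^sup>+t. ennreal (indicator {0..} t * t powr (x - 1) / exp t) \<partial>lborel)"
  proof (intro nn_integral_mono)
    fix t :: real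
    have "c powr (x - 1) * exp (- (c + 1)) \<le> t powr (x - 1) * exp (- t)" if "c \<le> t" "t \<le> c + 1"
      using that c x by (intro mult_mono powr_mono2) auto
    then show "ennreal (c powr (x - 1) * exp (- (c + 1))) * indicator {c..c + 1} t
        \<le> ennreal (indicator {0..} t * t powr (x - 1) / exp t)"
      using c by (auto simp: indicator_def exp_minus field_simps intro!: ennreal_leI)
  qed
  also have "\<dots> = ennreal (Gamma x)"
    using x by (subst Gamma_conv_nn_integral_real) auto
  finally show ?thesis
    using x by (subst (asm) ennreal_le_iff) (auto intro: less_imp_le)
qed

lemma summable_mittag_leffler:
  fixes \<alpha> \<beta> z :: real
  assumes \<alpha>: "\<alpha> > 0" and \<beta>: "\<beta> > 0"
  shows "summable (\<lambda>n. z ^ n / Gamma (\<alpha> * real n + \<beta>))"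
proof -
  \<comment> \<open>Chosen so that \<open>c powr \<alpha> = 2 * \<bar>z\<bar> + 1\<close>: the lower
    bound for Gamma then makes the terms decay geometrically with ratio
    \<open>r < 1\<close>.\<close>
  define c where "c = (2 * \<bar>z\<bar> + 1) powr (1 / \<alpha>)"
  have c1: "c \<ge> 1" unfolding c_def using \<alpha> by (intro ge_one_powr_ge_zero) auto
  have c\<alpha>: "c powr \<alpha> = 2 * \<bar>z\<bar> + 1" using \<alpha> by (simp add: c_def powr_powr)
  define C where "C = exp (c + 1) * c powr (1 - \<beta>)"
  define r where "r = \<bar>z\<bar> / (2 * \<bar>z\<bar> + 1)"
  have r: "norm r < 1" by (simp add: r_def field_simps)
  have "eventually (\<lambda>n. norm (z ^ n / Gamma (\<alpha> * real n + \<beta>)) \<le> C * r ^ n) sequentially"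
  proof -
    have "filterlim (\<lambda>n. \<alpha> * real n) at_top sequentially"
      using \<alpha> by (intro filterlim_tendsto_pos_mult_at_top[OF tendsto_const] filterlim_real_sequentially)
    then have "eventually (\<lambda>n. \<alpha> * real n \<ge> 1) sequentially"
      by (auto simp: filterlim_at_top)
    then show ?thesis
    proof eventually_elim
      fix n assume n: "\<alpha> * real n \<ge> 1"
      let ?x = "\<alpha> * real n + \<beta>"
      have x: "?x \<ge> 1" using n \<beta> by simp
      have "c powr (?x - 1) = c powr (\<alpha> * real n) * c powr (\<beta> - 1)"
        by (simp flip: powr_add add: algebra_simps)
      also have "c powr (\<alpha> * real n) = (2 * \<bar>z\<bar> + 1) ^ n"
        using c1 by (simp add: powr_powr[symmetric] c\<alpha> powr_realpow)
      finally have lb: "(2 * \<bar>z\<bar> + 1) ^ n * c powr (\<beta> - 1) * exp (- (c + 1)) \<le> Gamma ?x"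
        using Gamma_real_lower_bound[OF c1 x] by simp
      have "norm (z ^ n / Gamma ?x) = \<bar>z\<bar> ^ n / Gamma ?x"
        using x Gamma_real_pos[of ?x] by (simp add: power_abs abs_of_pos)
      also have "\<dots> \<le> \<bar>z\<bar> ^ n / ((2 * \<bar>z\<bar> + 1) ^ n * c powr (\<beta> - 1) * exp (- (c + 1)))"
        using lb c1 x by (intro divide_left_mono) (auto intro!: mult_pos_pos Gamma_real_pos zero_less_power)
      also have "\<dots> = C * r ^ n"
      proof -
        have "c powr (1 - \<beta>) = inverse (c powr (\<beta> - 1))"
          by (metis minus_diff_eq powr_minus)
        moreover have "exp (- (c + 1)) = inverse (exp (c + 1))" by (rule exp_minus)
        ultimately show ?thesis
          by (simp only: C_def r_def power_divide) (simp add: field_simps del: exp_minus)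
      qed
      finally show "norm (z ^ n / Gamma ?x) \<le> C * r ^ n" .
    qed
  qed
  then show ?thesis
    by (rule summable_comparison_test_ev) (intro summable_mult summable_geometric r)
qed

lemma continuous_on_mittag_leffler:
  assumes "\<alpha> > 0"
  shows "continuous_on A (mittag_leffler \<alpha>)"
proof -
  have "isCont (\<lambda>z. \<Sum>k. (1 / Gamma (\<alpha> * real k + 1)) * z ^ k) z" for z
    by (rule isCont_powser_converges_everywhere)
       (use summable_mittag_leffler[OF assms zero_less_one] in simp)
  then show ?thesis
    by (simp add: mittag_leffler_def[abs_def] continuous_at_imp_continuous_on)
qed

lemma kernel_on_mittag_leffler:
  assumes "\<alpha> > 0"
  shows "kernel_on b (\<lambda>t. mittag_leffler \<alpha> (\<omega> * t powr \<alpha>))"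
proof -
  have [measurable]: "mittag_leffler \<alpha> \<in> borel_measurable borel"
    by (intro borel_measurable_continuous_onI continuous_on_mittag_leffler assms)
  have "(\<lambda>t. mittag_leffler \<alpha> (\<omega> * t powr \<alpha>)) \<in> borel_measurable borel"
    by measurable
  moreover have "continuous_on {0..b} (\<lambda>t. mittag_leffler \<alpha> (\<omega> * t powr \<alpha>))"
    by (intro continuous_on_compose2[OF continuous_on_mittag_leffler[OF assms, of UNIV]]
        continuous_intros continuous_on_powr') (use assms in auto)
  ultimately show ?thesis by (simp add: kernel_on_def)
qed

lemma mittag_leffler_0 [simp]: "mittag_leffler \<alpha> 0 = 1"
proof -
  have "mittag_leffler \<alpha> 0 = (\<Sum>k. (1 / Gamma (\<alpha> * real k + 1)) * 0 ^ k)"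
    by (simp add: mittag_leffler_def)
  also have "\<dots> = 1" by (subst powser_zero) simp
  finally show ?thesis .
qed

text \<open>\<open>t\<^sup>\<beta>\<^sup>-\<^sup>1 E\<^sub>\<alpha>\<^sub>,\<^sub>\<beta>(\<omega> t\<^sup>\<alpha>)\<close> for the two-parameter Mittag-Leffler function.
  Since \<open>0 powr 0 = 0\<close>, the case \<open>\<beta> = 1\<close> agrees with \<open>E\<^sub>\<alpha>(\<omega> t\<^sup>\<alpha>)\<close> only for \<open>t > 0\<close>.\<close>

definition mittag_leffler_kernel :: "real \<Rightarrow> real \<Rightarrow> real \<Rightarrow> real \<Rightarrow> real" where
  "mittag_leffler_kernel \<alpha> \<beta> \<omega> t = (\<Sum>n. \<omega> ^ n * t powr (\<alpha> * real n + \<beta> - 1) / Gamma (\<alpha> * real n + \<beta>))"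

section \<open>Riemann-Liouville power kernels and their convolutions\<close>

definition power_kernel :: "real \<Rightarrow> real \<Rightarrow> real" where
  "power_kernel a t = t powr (a - 1) / Gamma a"

lemma power_kernel_measurable [measurable]: "power_kernel a \<in> borel_measurable borel"
  unfolding power_kernel_def[abs_def] by measurable

lemma mittag_leffler_kernel_measurable [measurable]:
  "mittag_leffler_kernel \<alpha> \<beta> \<omega> \<in> borel_measurable borel"
  unfolding mittag_leffler_kernel_def[abs_def] by measurable

text \<open>The Beta integral, rescaled from the unit interval to \<open>{0..t}\<close>; it is the
  semigroup law of fractional integration. \<open>has_bochner_integral\<close> records integrability
  together with the value.\<close>

lemma power_kernel_conv:
  assumes a: "a > 0" and c: "c > 0" and t: "t > 0"
  shows "has_bochner_integral lborel
    (\<lambda>s. indicator {0..t} s * (power_kernel a (t - s) * power_kernel c s)) (power_kernel (c + a) t)"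
proof -
  let ?B = "\<lambda>x. indicator {0..1} x * (x powr (c - 1) * (1 - x) powr (a - 1))"
  have "set_integrable lborel {0..1} (\<lambda>x. x powr (c - 1) * (1 - x) powr (a - 1))"
    by (rule integrable_Beta[OF c a])
  moreover from set_borel_integral_eq_integral(2)[OF this]
  have "(LINT x:{0..1}|lborel. x powr (c - 1) * (1 - x) powr (a - 1)) = Beta c a"
    using has_integral_Beta_real[OF c a] by (simp add: integral_unique)
  ultimately have "has_bochner_integral lborel ?B (Beta c a)"
    by (simp add: has_bochner_integral_iff set_integrable_def set_lebesgue_integral_def)
  then have "has_bochner_integral lborel (\<lambda>s. ?B (0 + (1 / t) * s)) (Beta c a /\<^sub>R \<bar>1 / t\<bar>)"
    using t by (subst lborel_has_bochner_integral_real_affine_iff[symmetric]) auto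
  then have "has_bochner_integral lborel
      (\<lambda>s. t powr (c + a - 2) / (Gamma a * Gamma c) * ?B (0 + (1 / t) * s))
      (t powr (c + a - 2) / (Gamma a * Gamma c) * (Beta c a /\<^sub>R \<bar>1 / t\<bar>))"
    by (rule has_bochner_integral_mult_right)
  also have "t powr (c + a - 2) / (Gamma a * Gamma c) * (Beta c a /\<^sub>R \<bar>1 / t\<bar>) = power_kernel (c + a) t"
  proof -
    have "Gamma a > 0" "Gamma c > 0" using a c by auto
    moreover have "t powr (c + a - 1) = t powr (c + a - 2) * t"
      using t powr_add[of t "c + a - 2" 1] by (simp add: algebra_simps)
    ultimately show ?thesis
      using t by (simp add: power_kernel_def Beta_def field_simps)
  qed
  also have "(\<lambda>s. t powr (c + a - 2) / (Gamma a * Gamma c) * ?B (0 + (1 / t) * s))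
      = (\<lambda>s. indicator {0..t} s * (power_kernel a (t - s) * power_kernel c s))"
  proof
    fix s
    have ind: "indicator {0..1} (s / t) = (indicator {0..t} s :: real)"
      using t by (auto simp: indicator_def field_simps)
    have "t powr (c + a - 2) * ((s / t) powr (c - 1) * (1 - s / t) powr (a - 1))
        = s powr (c - 1) * (t - s) powr (a - 1)" if s: "s \<in> {0..t}"
    proof -
      have "(1 - s / t) = (t - s) / t" using t by (simp add: field_simps)
      moreover have "t powr (c + a - 2) = t powr (c - 1) * t powr (a - 1)"
        by (simp flip: powr_add add: algebra_simps)
      ultimately show ?thesis using t s by (simp add: powr_divide)
    qed
    then show "t powr (c + a - 2) / (Gamma a * Gamma c) * ?B (0 + (1 / t) * s)
        = indicator {0..t} s * (power_kernel a (t - s) * power_kernel c s)"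
      using t by (cases "s \<in> {0..t}") (simp_all add: ind power_kernel_def field_simps)
  qed
  finally show ?thesis .
qed

lemma summable_mittag_leffler_kernel:
  assumes "\<alpha> > 0" "\<beta> > 0" "t > 0"
  shows "summable (\<lambda>n. \<omega> ^ n * power_kernel (\<alpha> * real n + \<beta>) t)"
proof -
  have "\<omega> ^ n * power_kernel (\<alpha> * real n + \<beta>) t
      = t powr (\<beta> - 1) * ((\<omega> * t powr \<alpha>) ^ n / Gamma (\<alpha> * real n + \<beta>))" for n
  proof -
    have "t powr (\<alpha> * real n + \<beta> - 1) = t powr (\<beta> - 1) * (t powr \<alpha>) ^ n"
      using assms by (simp add: powr_power flip: powr_add) (simp add: algebra_simps)
    then show ?thesis by (simp add: power_kernel_def power_mult_distrib)
  qed
  then show ?thesis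
    using summable_mult[OF summable_mittag_leffler[OF assms(1,2)]] by simp
qed

lemma power_kernel_nonneg: "a > 0 \<Longrightarrow> power_kernel a t \<ge> 0"
  by (simp add: power_kernel_def less_imp_le)

lemma mittag_leffler_kernel_altdef:
  "mittag_leffler_kernel \<alpha> \<beta> \<omega> t = (\<Sum>n. \<omega> ^ n * power_kernel (\<alpha> * real n + \<beta>) t)"
  by (simp add: mittag_leffler_kernel_def power_kernel_def)

text \<open>Termwise use of the Beta integral: each exponent rises by \<open>a\<close>, which
  amounts to replacing \<open>\<beta>\<close> by \<open>\<beta> + a\<close>.\<close>

lemma power_kernel_conv_mittag_leffler_kernel:
  assumes a: "a > 0" and \<alpha>: "\<alpha> > 0" and \<beta>: "\<beta> > 0" and t: "t > 0"
  shows "has_bochner_integral lborel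
    (\<lambda>s. indicator {0..t} s * (power_kernel a (t - s) * mittag_leffler_kernel \<alpha> \<beta> \<omega> s))
    (mittag_leffler_kernel \<alpha> (\<beta> + a) \<omega> t)"
proof -
  define f where "f n s = \<omega> ^ n *
    (indicator {0..t} s * (power_kernel a (t - s) * power_kernel (\<alpha> * real n + \<beta>) s))" for n s
  have pos: "\<alpha> * real n + \<beta> > 0" for n using \<alpha> \<beta> by (simp add: add_nonneg_pos)
  have base: "has_bochner_integral lborel
      (\<lambda>s. indicator {0..t} s * (power_kernel a (t - s) * power_kernel (\<alpha> * real n + \<beta>) s))
      (power_kernel (\<alpha> * real n + (\<beta> + a)) t)" for n
    using power_kernel_conv[OF a pos t] by (simp add: add.assoc)
  have f: "has_bochner_integral lborel (f n) (\<omega> ^ n * power_kernel (\<alpha> * real n + (\<beta> + a)) t)" for n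
    unfolding f_def using base by (rule has_bochner_integral_mult_right)
  have nf: "norm (f n s) = \<bar>\<omega>\<bar> ^ n *
      (indicator {0..t} s * (power_kernel a (t - s) * power_kernel (\<alpha> * real n + \<beta>) s))" for n s
    using power_kernel_nonneg[OF a] power_kernel_nonneg[OF pos]
    by (simp add: f_def abs_mult power_abs)
  \<comment> \<open>The L1 norms form the same kind of series with
    \<open>\<bar>\<omega>\<bar>\<close> in place of \<open>\<omega>\<close>, which converges and so
    permits exchanging sum and integral.\<close>
  have inf: "(\<integral>s. norm (f n s) \<partial>lborel) = \<bar>\<omega>\<bar> ^ n * power_kernel (\<alpha> * real n + (\<beta> + a)) t" for n
    unfolding nf using has_bochner_integral_mult_right[OF base, of "\<bar>\<omega>\<bar> ^ n" n]
    by (rule has_bochner_integral_integral_eq)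
  have sum_s: "(\<Sum>n. f n s) = indicator {0..t} s * (power_kernel a (t - s) * mittag_leffler_kernel \<alpha> \<beta> \<omega> s)"
    and summ_s: "summable (\<lambda>n. norm (f n s))" if s: "s \<noteq> 0" for s
  proof -
    consider "s > 0" | "s < 0" using s by linarith
    then have "(\<Sum>n. f n s) = indicator {0..t} s * (power_kernel a (t - s) * mittag_leffler_kernel \<alpha> \<beta> \<omega> s)
        \<and> summable (\<lambda>n. norm (f n s))"
    proof cases
      case 1
      have "(\<Sum>n. f n s) = (\<Sum>n. (indicator {0..t} s * power_kernel a (t - s)) *
          (\<omega> ^ n * power_kernel (\<alpha> * real n + \<beta>) s))"
        by (simp add: f_def mult_ac)
      also have "\<dots> = (indicator {0..t} s * power_kernel a (t - s)) * mittag_leffler_kernel \<alpha> \<beta> \<omega> s"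
        unfolding mittag_leffler_kernel_altdef
        by (rule suminf_mult[OF summable_mittag_leffler_kernel[OF \<alpha> \<beta> 1]])
      finally have "(\<Sum>n. f n s) = indicator {0..t} s * (power_kernel a (t - s) * mittag_leffler_kernel \<alpha> \<beta> \<omega> s)"
        by (simp add: mult.assoc)
      moreover have "summable (\<lambda>n. (indicator {0..t} s * power_kernel a (t - s)) *
          (\<bar>\<omega>\<bar> ^ n * power_kernel (\<alpha> * real n + \<beta>) s))"
        by (intro summable_mult summable_mittag_leffler_kernel \<alpha> \<beta> 1)
      then have "summable (\<lambda>n. norm (f n s))" unfolding nf by (simp add: mult_ac)
      ultimately show ?thesis by blast
    next
      case 2
      then show ?thesis by (simp add: f_def)
    qed
    then show "(\<Sum>n. f n s) = indicator {0..t} s * (power_kernel a (t - s) * mittag_leffler_kernel \<alpha> \<beta> \<omega> s)"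
      "summable (\<lambda>n. norm (f n s))" by blast+
  qed
  have ae0: "AE s in lborel. s \<noteq> (0::real)" by (rule AE_lborel_singleton)
  have int: "integrable lborel (f n)" for n using f by (rule integrable.intros)
  have ae: "AE s in lborel. summable (\<lambda>n. norm (f n s))"
    using ae0 by eventually_elim (rule summ_s)
  have sm: "summable (\<lambda>n. \<integral>s. norm (f n s) \<partial>lborel)"
    unfolding inf by (intro summable_mittag_leffler_kernel \<alpha> add_pos_pos \<beta> a t)
  have "has_bochner_integral lborel (\<lambda>s. \<Sum>n. f n s) (\<Sum>n. integral\<^sup>L lborel (f n))"
    using integrable_suminf[OF int ae sm] integral_suminf[OF int ae sm]
    by (simp add: has_bochner_integral_iff)
  also have "(\<Sum>n. integral\<^sup>L lborel (f n)) = mittag_leffler_kernel \<alpha> (\<beta> + a) \<omega> t"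
    unfolding mittag_leffler_kernel_altdef has_bochner_integral_integral_eq[OF f] ..
  finally show ?thesis
    by (rule has_bochner_integral_cong_AE[THEN iffD1, rotated -1])
       (use ae0 in \<open>auto simp: f_def simp flip: sum_s elim!: eventually_mono\<close>)
qed

lemma power_kernel_1: "t > 0 \<Longrightarrow> power_kernel 1 t = 1"
  by (simp add: power_kernel_def)

text \<open>Integrability is read off from the convolution with \<open>power_kernel 1\<close> at
  \<open>b\<close>: that kernel is 1 except at 0, where \<open>0 powr 0 = 0\<close>, so the
  integrands differ only at \<open>s = b\<close>.\<close>

lemma integrable_to_mittag_leffler_kernel:
  assumes "\<alpha> > 0" "\<beta> > 0" "b > 0"
  shows "integrable_to b (mittag_leffler_kernel \<alpha> \<beta> \<omega>)"
proof -
  have "integrable lborel (\<lambda>s. indicator {0..b} s * (power_kernel 1 (b - s) * mittag_leffler_kernel \<alpha> \<beta> \<omega> s))"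
    using power_kernel_conv_mittag_leffler_kernel[OF zero_less_one assms] by (rule integrable.intros)
  then have "integrable lborel (\<lambda>s. indicator {0..b} s *\<^sub>R mittag_leffler_kernel \<alpha> \<beta> \<omega> s)"
  proof (rule integrable_cong_AE_imp)
    have "AE s in lborel. s \<noteq> b" by (rule AE_lborel_singleton)
    then show "AE s in lborel. indicator {0..b} s * (power_kernel 1 (b - s) * mittag_leffler_kernel \<alpha> \<beta> \<omega> s)
        = indicator {0..b} s *\<^sub>R mittag_leffler_kernel \<alpha> \<beta> \<omega> s"
      by eventually_elim (auto simp: indicator_def power_kernel_1)
  qed auto
  then show ?thesis by (simp add: integrable_to_def set_integrable_def)
qed

lemma integrable_to_power_kernel:
  assumes "a > 0" "b > 0"
  shows "integrable_to b (power_kernel a)"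
proof -
  have "integrable lborel (\<lambda>s. indicator {0..b} s * (power_kernel 1 (b - s) * power_kernel a s))"
    using power_kernel_conv[OF zero_less_one assms] by (rule integrable.intros)
  then have "integrable lborel (\<lambda>s. indicator {0..b} s *\<^sub>R power_kernel a s)"
  proof (rule integrable_cong_AE_imp)
    have "AE s in lborel. s \<noteq> b" by (rule AE_lborel_singleton)
    then show "AE s in lborel. indicator {0..b} s * (power_kernel 1 (b - s) * power_kernel a s)
        = indicator {0..b} s *\<^sub>R power_kernel a s"
      by eventually_elim (auto simp: indicator_def power_kernel_1)
  qed auto
  then show ?thesis by (simp add: integrable_to_def set_integrable_def)
qed

lemma mittag_leffler_kernel_eq_mittag_leffler:
  assumes "t > 0"
  shows "mittag_leffler_kernel \<alpha> 1 \<omega> t = mittag_leffler \<alpha> (\<omega> * t powr \<alpha>)"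
  unfolding mittag_leffler_kernel_def mittag_leffler_def
  using assms by (simp add: power_mult_distrib powr_power mult.commute[of _ \<alpha>])

lemma power_kernel_conv_mittag_leffler:
  assumes a: "a > 0" and \<alpha>: "\<alpha> > 0" and t: "t > 0"
  shows "laplace_conv (power_kernel a) (\<lambda>s. mittag_leffler \<alpha> (\<omega> * s powr \<alpha>)) t
    = mittag_leffler_kernel \<alpha> (1 + a) \<omega> t"
proof -
  have [measurable]: "(\<lambda>s. mittag_leffler \<alpha> (\<omega> * s powr \<alpha>)) \<in> borel_measurable borel"
    using kernel_on_mittag_leffler[OF \<alpha>] by (simp add: kernel_on_def)
  have "laplace_conv (power_kernel a) (\<lambda>s. mittag_leffler \<alpha> (\<omega> * s powr \<alpha>)) t
      = laplace_conv (power_kernel a) (mittag_leffler_kernel \<alpha> 1 \<omega>) t"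
    by (intro laplace_conv_cong) (auto simp: mittag_leffler_kernel_eq_mittag_leffler)
  also have "\<dots> = mittag_leffler_kernel \<alpha> (1 + a) \<omega> t"
    using power_kernel_conv_mittag_leffler_kernel[OF a \<alpha> zero_less_one t]
    by (subst laplace_conv_lborel) (auto dest: has_bochner_integral_integral_eq)
  finally show ?thesis .
qed

text \<open>The term \<open>n = 0\<close> of the series is 1; shifting the index in the others
  releases a factor \<open>\<omega>\<close> and raises \<open>\<beta>\<close> from 1 to
  \<open>1 + \<alpha>\<close>, which is convolution with the power kernel.\<close>

lemma mittag_leffler_integral_equation:
  assumes \<alpha>: "\<alpha> > 0" and t: "t \<ge> 0"
  shows "mittag_leffler \<alpha> (\<omega> * t powr \<alpha>) =
    1 + \<omega> * laplace_conv (power_kernel \<alpha>) (\<lambda>s. mittag_leffler \<alpha> (\<omega> * s powr \<alpha>)) t"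
proof (cases "t = 0")
  case True
  have "(\<lambda>s. mittag_leffler \<alpha> (\<omega> * s powr \<alpha>)) \<in> borel_measurable borel"
    using kernel_on_mittag_leffler[OF \<alpha>] by (simp add: kernel_on_def)
  then show ?thesis using True by (simp add: laplace_conv_0)
next
  case False
  then have t: "t > 0" using t by simp
  note sm = summable_mittag_leffler_kernel[OF \<alpha> _ t]
  have "mittag_leffler \<alpha> (\<omega> * t powr \<alpha>) = (\<Sum>n. \<omega> ^ n * power_kernel (\<alpha> * real n + 1) t)"
    using mittag_leffler_kernel_eq_mittag_leffler[OF t] mittag_leffler_kernel_altdef by simp
  also have "\<dots> = 1 + (\<Sum>n. \<omega> * (\<omega> ^ n * power_kernel (\<alpha> * real n + (1 + \<alpha>)) t))"
    using suminf_split_head[OF sm[of 1 \<omega>]] t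
    by (simp add: power_kernel_1 algebra_simps)
  also have "\<dots> = 1 + \<omega> * mittag_leffler_kernel \<alpha> (1 + \<alpha>) \<omega> t"
    unfolding mittag_leffler_kernel_altdef using \<alpha> by (subst suminf_mult) (auto intro!: sm)
  finally show ?thesis
    using power_kernel_conv_mittag_leffler[OF \<alpha> \<alpha> t] by simp
qed

text \<open>Both sides are the kernel with \<open>\<beta> = \<alpha> + 1\<close>. The right one
  exhibits the convolution as a primitive of an integrable function, and thereby supplies a
  derivative of \<open>g\<close>.\<close>

lemma power_kernel_conv_mittag_leffler_primitive:
  assumes \<alpha>: "\<alpha> > 0" and t: "t \<ge> 0"
  shows "laplace_conv (power_kernel \<alpha>) (\<lambda>s. mittag_leffler \<alpha> (\<omega> * s powr \<alpha>)) t
    = laplace_conv (\<lambda>_. 1) (mittag_leffler_kernel \<alpha> \<alpha> \<omega>) t"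
proof (cases "t = 0")
  case True
  have "(\<lambda>s. mittag_leffler \<alpha> (\<omega> * s powr \<alpha>)) \<in> borel_measurable borel"
    using kernel_on_mittag_leffler[OF \<alpha>] by (simp add: kernel_on_def)
  then show ?thesis using True by (simp add: laplace_conv_0)
next
  case False
  then have t: "t > 0" using t by simp
  have "laplace_conv (\<lambda>_. 1) (mittag_leffler_kernel \<alpha> \<alpha> \<omega>) t
      = laplace_conv (power_kernel 1) (mittag_leffler_kernel \<alpha> \<alpha> \<omega>) t"
    by (intro laplace_conv_cong) (auto simp: power_kernel_1)
  also have "\<dots> = mittag_leffler_kernel \<alpha> (\<alpha> + 1) \<omega> t"
    using power_kernel_conv_mittag_leffler_kernel[OF zero_less_one \<alpha> \<alpha> t]
    by (subst laplace_conv_lborel) (auto dest: has_bochner_integral_integral_eq)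
  finally show ?thesis
    using power_kernel_conv_mittag_leffler[OF \<alpha> \<alpha> t] by (simp add: add.commute)
qed

section \<open>The initial value problem\<close>

lemma kernel_on_const: "kernel_on b (\<lambda>_. c)"
  by (simp add: kernel_on_def)

lemma kernel_on_linear:
  assumes "kernel_on b p" "kernel_on b q"
  shows "kernel_on b (\<lambda>s. x * p s + y * q s)"
  using assms by (auto simp: kernel_on_def intro!: continuous_intros)

theorem lemma3p3:
  fixes B f g u :: "real \<Rightarrow> real" and b \<alpha> lam u0 \<omega> :: real
  assumes b: "b > 0"
    and alpha: "0 < \<alpha>" "\<alpha> < 1"
    and B_pos: "\<And>a. a \<in> {0..1} \<Longrightarrow> B a > 0"
    and B_ends: "B 0 = 1" "B 1 = 1"
    and f: "f \<in> H1C b"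
    and denom: "B \<alpha> - lam * (1 - \<alpha>) \<noteq> 0"
    and omega: "\<omega> = lam * \<alpha> / (B \<alpha> - lam * (1 - \<alpha>))"
    and g: "g = (\<lambda>t. mittag_leffler \<alpha> (\<omega> * t powr \<alpha>)
               + \<alpha> / (1 - \<alpha>) * laplace_conv (\<lambda>s. s powr (\<alpha> - 1) / Gamma \<alpha>)
                                  (\<lambda>s. mittag_leffler \<alpha> (\<omega> * s powr \<alpha>)) t)"
    and u: "u = (\<lambda>t. 1 / (B \<alpha> - lam * (1 - \<alpha>)) *
               (B \<alpha> * u0 * mittag_leffler \<alpha> (\<omega> * t powr \<alpha>)
                + (1 - \<alpha>) * (laplace_conv g (weak_derivative {0<..<b} f) t + f 0 * g t)))"
  shows "(is_unique_solution B b \<alpha> lam f u0 u \<longleftrightarrow> lam * u0 + f 0 = 0) \<and>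
         ((\<exists>v. is_unique_solution B b \<alpha> lam f u0 v) \<longleftrightarrow> lam * u0 + f 0 = 0)"
proof -

  \<comment> \<open>Kernels and resolvent identities\<close>
  define D where "D = B \<alpha> - lam * (1 - \<alpha>)"
  define \<mu> where "\<mu> = \<alpha> / (1 - \<alpha>)"
  define h where "h = power_kernel \<alpha>"
  define e where "e = (\<lambda>t. mittag_leffler \<alpha> (\<omega> * t powr \<alpha>))"
  define k where "k = (\<lambda>t. mittag_leffler \<alpha> (- \<mu> * t powr \<alpha>))"
  define one where "one = (\<lambda>_::real. 1::real)"
  define he where "he = laplace_conv h e"
  have D: "D \<noteq> 0" and wD: "\<omega> * D = lam * \<alpha>" and \<mu>: "\<mu> > 0" "(1 - \<alpha>) * \<mu> = \<alpha>"
    and B: "B \<alpha> > 0"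
    using denom alpha B_pos[of \<alpha>] by (auto simp: D_def omega \<mu>_def)
  have e: "kernel_on b e" unfolding e_def by (rule kernel_on_mittag_leffler) fact
  have k: "kernel_on b k" unfolding k_def by (rule kernel_on_mittag_leffler) fact
  have h: "integrable_to b h" unfolding h_def by (rule integrable_to_power_kernel) fact+
  have one: "kernel_on b one" unfolding one_def by (rule kernel_on_const)
  note [measurable] = kernel_on_measurable[OF e] kernel_on_measurable[OF k]
    integrable_to_measurable[OF h] kernel_on_measurable[OF one]
  have commute: "laplace_conv p q = laplace_conv q p"
    if [measurable]: "p \<in> borel_measurable borel" "q \<in> borel_measurable borel" for p q
    by (rule ext) (rule laplace_conv_commute[OF that])
  have he: "kernel_on b he"
    unfolding he_def by (subst commute, measurable) (rule kernel_on_conv[OF e h])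
  note [measurable] = kernel_on_measurable[OF he]
  have g_eq: "g = (\<lambda>t. 1 * e t + \<mu> * he t)"
    by (simp add: g e_def he_def h_def power_kernel_def[abs_def] \<mu>_def)
  have g: "kernel_on b g" unfolding g_eq by (rule kernel_on_linear[OF e he])
  note [measurable] = kernel_on_measurable[OF g]
  have e_eq: "e t = 1 + \<omega> * he t" if "t \<in> {0..b}" for t
    using mittag_leffler_integral_equation[OF alpha(1), of t \<omega>] that
    by (simp add: e_def he_def h_def)
  have hk: "laplace_conv h k t = (1 / \<mu>) * 1 - (1 / \<mu>) * k t" if "t \<in> {0..b}" for t
    using mittag_leffler_integral_equation[OF alpha(1), of t "-\<mu>"] that \<mu>
    by (simp add: k_def h_def field_simps)
  \<comment> \<open>The coefficients of \<open>he\<close> cancel, because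
    \<open>lam * (1 - \<alpha>) * \<mu> = lam * \<alpha> = \<omega> * D\<close>.\<close>
  have Beg: "B \<alpha> * e t - lam * (1 - \<alpha>) * g t = D" if "t \<in> {0..b}" for t
  proof -
    have "lam * (1 - \<alpha>) * g t = lam * (1 - \<alpha>) * e t + lam * ((1 - \<alpha>) * \<mu>) * he t"
      by (simp add: g_eq algebra_simps)
    also have "\<dots> = lam * (1 - \<alpha>) * e t + D * (\<omega> * he t)"
      by (simp only: \<mu>(2) wD[symmetric]) (simp add: algebra_simps)
    also have "\<omega> * he t = e t - 1" using e_eq[OF that] by simp
    finally show ?thesis by (simp add: D_def algebra_simps)
  qed
  \<comment> \<open>\<open>\<gamma>\<close> plays the part of the derivative of \<open>g\<close>:
    the integral equation gives \<open>g = 1 + (\<omega> + \<mu>) * he\<close>, and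
    \<open>he\<close> is a primitive. Its singularity of order \<open>\<alpha> - 1\<close> at 0 is
    integrable, but need not be square integrable.\<close>
  define \<gamma> where "\<gamma> = (\<lambda>s. (\<omega> + \<mu>) * mittag_leffler_kernel \<alpha> \<alpha> \<omega> s)"
  have \<gamma>: "integrable_to b \<gamma>"
    using integrable_to_mittag_leffler_kernel[OF alpha(1) alpha(1) b, of \<omega>]
    by (auto simp: \<gamma>_def integrable_to_def)
  note [measurable] = integrable_to_measurable[OF \<gamma>]
  have g_prim: "g t = 1 * one t + 1 * laplace_conv one \<gamma> t" if "t \<in> {0..b}" for t
    using power_kernel_conv_mittag_leffler_primitive[OF alpha(1), of t \<omega>] e_eq[OF that] that
    unfolding \<gamma>_def laplace_conv_scale_right
    by (simp add: g_eq one_def h_def e_def he_def algebra_simps)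
  have assoc: "laplace_conv p (laplace_conv q r) t = laplace_conv (laplace_conv p q) r t"
    if "kernel_on b p" "integrable_to b q" "integrable_to b r" "t \<in> {0..b}" for p q r t
    using laplace_conv_assoc[of b p q r t] that by simp

  \<comment> \<open>In Laplace transforms: \<open>s\<^sup>\<alpha>\<^sup>-\<^sup>1/(s\<^sup>\<alpha> + \<mu>) \<cdot> s\<^sup>-\<^sup>1(s\<^sup>\<alpha> + \<mu>)/(s\<^sup>\<alpha> - \<omega>) = s\<^sup>-\<^sup>1 \<cdot> s\<^sup>\<alpha>\<^sup>-\<^sup>1/(s\<^sup>\<alpha> - \<omega>)\<close>.\<close>
  have kg: "laplace_conv k g t = laplace_conv one e t" if t: "t \<in> {0..b}" for t
  proof -
    have "laplace_conv k g t = laplace_conv g k t" by (rule laplace_conv_commute; measurable)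
    also have "\<dots> = 1 * laplace_conv e k t + \<mu> * laplace_conv he k t"
      unfolding g_eq using t by (intro laplace_conv_linear_left[OF e he kernel_on_integrable_to[OF k]]) auto
    also have "laplace_conv he k t = laplace_conv (laplace_conv e h) k t"
      unfolding he_def by (subst commute) auto
    also have "\<dots> = laplace_conv e (laplace_conv h k) t"
      by (rule assoc[symmetric, OF e h kernel_on_integrable_to[OF k] t])
    also have "\<dots> = laplace_conv (laplace_conv h k) e t" by (rule laplace_conv_commute; measurable)
    also have "\<dots> = laplace_conv (\<lambda>s. (1 / \<mu>) * one s + (- 1 / \<mu>) * k s) e t"
      by (rule laplace_conv_cong) (use t hk in \<open>auto simp: one_def\<close>)
    also have "\<dots> = (1 / \<mu>) * laplace_conv one e t + (- 1 / \<mu>) * laplace_conv k e t"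
      using t by (intro laplace_conv_linear_left[OF one k kernel_on_integrable_to[OF e]]) auto
    also have "laplace_conv k e t = laplace_conv e k t" by (rule laplace_conv_commute; measurable)
    finally show ?thesis using \<mu> by (simp add: field_simps)
  qed

  \<comment> \<open>Replaces the arbitrary weak derivative by a Borel representative, turning the
    fractional equation into a convolution equation.\<close>
  have ABC: "ABC_derivative B b \<alpha> v t = B \<alpha> / (1 - \<alpha>) * laplace_conv k p t"
    if v: "AE x in lebesgue. x \<in> {0<..<b} \<longrightarrow> weak_derivative {0<..<b} v x = p x"
      and p: "integrable_to b p" and t: "t \<in> {0..b}" for v p t
  proof -
    have "ABC_derivative B b \<alpha> v t
        = B \<alpha> / (1 - \<alpha>) * laplace_conv k (weak_derivative {0<..<b} v) t"
      by (simp add: ABC_derivative_def laplace_conv_def k_def \<mu>_def)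
    also have "laplace_conv k (weak_derivative {0<..<b} v) t = laplace_conv k p t"
      using t integrable_to_measurable[OF p] by (intro laplace_conv_cong_AE[OF v]) auto
    finally show ?thesis .
  qed

  \<comment> \<open>Necessity of the compatibility condition\<close>
  have compat: "lam * u0 + f 0 = 0" if v: "v \<in> H1C b" "solves_ivp B b \<alpha> lam f u0 v" for v
  proof -
    obtain p where p: "square_integrable_to b p"
      and ae: "AE x in lebesgue. x \<in> {0<..<b} \<longrightarrow> weak_derivative {0<..<b} v x = p x"
      using H1C_primitive[OF b v(1)] by metis
    have p1: "integrable_to b p" by (rule square_integrable_to_imp_integrable_to[OF p])
    note [measurable] = integrable_to_measurable[OF p1]
    define d where "d t = B \<alpha> / (1 - \<alpha>) * laplace_conv k p t - (lam * v t + f t)" for t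
    have "continuous_on {0..b} v" "continuous_on {0..b} f"
      using v(1) f by (auto simp: H1C_def)
    moreover have "continuous_on {0..b} (laplace_conv k p)"
      using kernel_on_conv[OF k p1] by (simp add: kernel_on_def)
    ultimately have "continuous_on {0..b} d"
      unfolding d_def by (intro continuous_intros)
    moreover have "d t = 0" if "t \<in> {0<..<b}" for t
      using v(2) ABC[OF ae p1, of t] that by (auto simp: solves_ivp_def d_def)
    ultimately have "d 0 = 0"
      using continuous_constant_on_closure[of "{0<..<b}" d 0 0] b
      by (simp add: closure_greaterThanLessThan)
    moreover have "v 0 = u0" using v(2) by (simp add: solves_ivp_def)
    ultimately show ?thesis by (simp add: d_def laplace_conv_0)
  qed

  \<comment> \<open>Uniqueness\<close>
  have unique: "v t = v' t"
    if v: "v \<in> H1C b" "solves_ivp B b \<alpha> lam f u0 v"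
      and v': "v' \<in> H1C b" "solves_ivp B b \<alpha> lam f u0 v'" and t: "t \<in> {0..b}" for v v' t
  proof -
    obtain p where p: "square_integrable_to b p"
      and ae: "AE x in lebesgue. x \<in> {0<..<b} \<longrightarrow> weak_derivative {0<..<b} v x = p x"
      and vp: "\<And>t. t \<in> {0..b} \<Longrightarrow> v t = v 0 + laplace_conv one p t"
      using H1C_primitive[OF b v(1)] unfolding one_def by metis
    obtain p' where p': "square_integrable_to b p'"
      and ae': "AE x in lebesgue. x \<in> {0<..<b} \<longrightarrow> weak_derivative {0<..<b} v' x = p' x"
      and vp': "\<And>t. t \<in> {0..b} \<Longrightarrow> v' t = v' 0 + laplace_conv one p' t"
      using H1C_primitive[OF b v'(1)] unfolding one_def by metis
    have p1: "integrable_to b p" "integrable_to b p'"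
      by (rule square_integrable_to_imp_integrable_to; fact)+
    define \<delta> where "\<delta> = (\<lambda>s. p s - p' s)"
    have \<delta>: "integrable_to b \<delta>"
      using p1 by (auto simp: \<delta>_def integrable_to_def intro: set_integral_diff)
    note [measurable] = p1[THEN integrable_to_measurable] integrable_to_measurable[OF \<delta>]
    define d where "d = laplace_conv one \<delta>"
    have d: "kernel_on b d" unfolding d_def by (rule kernel_on_conv[OF one \<delta>])
    note [measurable] = kernel_on_measurable[OF d]
    have vd: "v t - v' t = d t" if "t \<in> {0..b}" for t
      using vp[OF that] vp'[OF that] v(2) v'(2) laplace_conv_diff_right[OF one p1, of t] that
      by (simp add: solves_ivp_def d_def \<delta>_def)
    have keq: "laplace_conv k \<delta> t = lam * (1 - \<alpha>) / B \<alpha> * d t" if t: "0 < t" "t \<le> b" for t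
    proof -
      have "B \<alpha> / (1 - \<alpha>) * laplace_conv k p t - B \<alpha> / (1 - \<alpha>) * laplace_conv k p' t
          = lam * (v t - v' t)"
        using v(2) v'(2) ABC[OF ae p1(1), of t] ABC[OF ae' p1(2), of t] t
        by (simp add: solves_ivp_def algebra_simps)
      also have "v t - v' t = d t" using vd t by simp
      finally have "B \<alpha> / (1 - \<alpha>) * laplace_conv k \<delta> t = lam * d t"
        using laplace_conv_diff_right[OF k p1, of t] t by (simp add: \<delta>_def right_diff_distrib)
      then show ?thesis using B alpha by (simp add: field_simps)
    qed
    \<comment> \<open>The convolution of \<open>g\<close> with
      \<open>laplace_conv k \<delta>\<close> is computed twice: by \<open>kg\<close> it is that of
      \<open>e\<close> with \<open>d\<close>, by \<open>keq\<close> a multiple of that of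
      \<open>g\<close> with \<open>d\<close>. Comparing them, \<open>Beg\<close> leaves only the
      constant \<open>D\<close>.\<close>
    have "laplace_conv one d t = 0" if t: "t \<in> {0..b}" for t
    proof -
      have "laplace_conv g (laplace_conv k \<delta>) t = laplace_conv (laplace_conv g k) \<delta> t"
        by (rule assoc[OF g kernel_on_integrable_to[OF k] \<delta> t])
      also have "\<dots> = laplace_conv (laplace_conv e one) \<delta> t"
        by (rule laplace_conv_cong) (use kg t in \<open>auto simp: commute[of g k] commute[of e one]\<close>)
      also have "\<dots> = laplace_conv e d t"
        unfolding d_def by (rule assoc[symmetric, OF e kernel_on_integrable_to[OF one] \<delta> t])
      finally have "laplace_conv e d t = laplace_conv g (laplace_conv k \<delta>) t" ..
      also have "\<dots> = laplace_conv g (\<lambda>s. lam * (1 - \<alpha>) / B \<alpha> * d s) t"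
        by (rule laplace_conv_cong) (use keq t in auto)
      finally have eq: "B \<alpha> * laplace_conv e d t + - (lam * (1 - \<alpha>)) * laplace_conv g d t = 0"
        using B unfolding laplace_conv_scale_right by simp
      have "laplace_conv (\<lambda>s. B \<alpha> * e s + - (lam * (1 - \<alpha>)) * g s) d t = 0"
        unfolding eq[symmetric] using t
        by (intro laplace_conv_linear_left[OF e g kernel_on_integrable_to[OF d]]) auto
      also have "laplace_conv (\<lambda>s. B \<alpha> * e s + - (lam * (1 - \<alpha>)) * g s) d t
          = laplace_conv (\<lambda>s. D * one s + 0 * one s) d t"
        by (rule laplace_conv_cong) (use Beg t in \<open>auto simp: one_def\<close>)
      also have "\<dots> = D * laplace_conv one d t + 0 * laplace_conv one d t"
        using t by (intro laplace_conv_linear_left[OF one one kernel_on_integrable_to[OF d]]) auto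
      finally show ?thesis using D by simp
    qed
    then have "d t = 0" using eq_0_if_integral_eq_0[OF b d _ t] unfolding one_def by blast
    then show ?thesis using vd[OF t] by simp
  qed

  \<comment> \<open>Existence under the compatibility condition\<close>
  have exists: "u \<in> H1C b \<and> solves_ivp B b \<alpha> lam f u0 u" if comp: "lam * u0 + f 0 = 0"
  proof -
    obtain p where p: "square_integrable_to b p"
      and ae: "AE x in lebesgue. x \<in> {0<..<b} \<longrightarrow> weak_derivative {0<..<b} f x = p x"
      and fp: "\<And>t. t \<in> {0..b} \<Longrightarrow> f t = f 0 + laplace_conv one p t"
      using H1C_primitive[OF b f] unfolding one_def by metis
    have p1: "integrable_to b p" by (rule square_integrable_to_imp_integrable_to[OF p])
    note [measurable] = integrable_to_measurable[OF p1]
    define c where "c = (1 - \<alpha>) / D"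
    have gp: "kernel_on b (laplace_conv g p)" by (rule kernel_on_conv[OF g p1])
    have ep: "kernel_on b (laplace_conv e p)" by (rule kernel_on_conv[OF e p1])
    have u_eq: "u t = u0 + c * laplace_conv g p t" if t: "t \<in> {0..b}" for t
    proof -
      have conv: "laplace_conv g (weak_derivative {0<..<b} f) t = laplace_conv g p t"
        using t by (intro laplace_conv_cong_AE[OF ae]) auto
      \<comment> \<open>Compatibility merges the terms with \<open>u0\<close> and \<open>f 0\<close>
        into \<open>u0\<close> times the combination in \<open>Beg\<close>, so they reduce to a
        constant.\<close>
      have "f 0 = - lam * u0" using comp by simp
      then have "B \<alpha> * u0 * e t + (1 - \<alpha>) * (f 0 * g t) = u0 * (B \<alpha> * e t - lam * (1 - \<alpha>) * g t)"
        by (simp add: algebra_simps)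
      also have "\<dots> = u0 * D" using Beg[OF t] by simp
      finally have *: "B \<alpha> * u0 * e t + (1 - \<alpha>) * (f 0 * g t) = u0 * D" .
      have "u t = 1 / D * (B \<alpha> * u0 * e t + (1 - \<alpha>) * (f 0 * g t) + (1 - \<alpha>) * laplace_conv g p t)"
        unfolding u conv by (simp add: D_def e_def algebra_simps)
      then show ?thesis unfolding * using D by (simp add: c_def field_simps)
    qed
    \<comment> \<open>Formally the derivative of \<open>c\<close> times the convolution of
      \<open>g\<close> with \<open>p\<close>: the initial value of \<open>g\<close> is 1 and its
      derivative is \<open>\<gamma>\<close>. Young's inequality makes \<open>q\<close> square
      integrable.\<close>
    define q where "q = (\<lambda>s. c * p s + c * laplace_conv \<gamma> p s)"
    have q: "square_integrable_to b q"
      unfolding q_def by (intro square_integrable_to_add square_integrable_to_conv p \<gamma>)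
    have "u t = u0 + laplace_conv one q t" if t: "t \<in> {0..b}" for t
    proof -
      have \<gamma>p: "integrable_to b (laplace_conv \<gamma> p)"
        by (rule integrable_to_conv[OF \<gamma> p1])
      note [measurable] = integrable_to_measurable[OF \<gamma>p]
      have one\<gamma>: "kernel_on b (laplace_conv one \<gamma>)" by (rule kernel_on_conv[OF one \<gamma>])
      note [measurable] = kernel_on_measurable[OF one\<gamma>]
      have "laplace_conv g p t = laplace_conv (\<lambda>s. 1 * one s + 1 * laplace_conv one \<gamma> s) p t"
        by (rule laplace_conv_cong) (use t in \<open>auto simp: g_prim\<close>)
      also have "\<dots> = 1 * laplace_conv one p t + 1 * laplace_conv (laplace_conv one \<gamma>) p t"
        using t by (intro laplace_conv_linear_left[OF one one\<gamma> p1]) auto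
      also have "laplace_conv (laplace_conv one \<gamma>) p t = laplace_conv one (laplace_conv \<gamma> p) t"
        by (rule assoc[symmetric, OF one \<gamma> p1 t])
      finally have "laplace_conv g p t = laplace_conv one p t + laplace_conv one (laplace_conv \<gamma> p) t"
        by simp
      moreover have "laplace_conv one q t
          = c * laplace_conv one p t + c * laplace_conv one (laplace_conv \<gamma> p) t"
        unfolding q_def using t by (intro laplace_conv_linear_right[OF one p1 \<gamma>p]) auto
      ultimately show ?thesis
        by (simp add: u_eq[OF t] distrib_left)
    qed
    then have uH: "u \<in> H1C b"
      using primitive_has_L2_weak_derivative[OF b q, of u u0] unfolding one_def
      by (auto simp: H1C_def H1_def)
    have u_0: "u 0 = u0" using u_eq[of 0] b by (simp add: laplace_conv_0)
    \<comment> \<open>\<open>ABC_derivative\<close> uses an arbitrary representative, which need not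
      be \<open>q\<close>. Only the primitive of \<open>w\<close> is used below, so no comparison
      with \<open>q\<close> is required.\<close>
    obtain w where w: "square_integrable_to b w"
      and aew: "AE x in lebesgue. x \<in> {0<..<b} \<longrightarrow> weak_derivative {0<..<b} u x = w x"
      and uw: "\<And>t. t \<in> {0..b} \<Longrightarrow> u t = u 0 + laplace_conv one w t"
      using H1C_primitive[OF b uH] unfolding one_def by metis
    have w1: "integrable_to b w" by (rule square_integrable_to_imp_integrable_to[OF w])
    note [measurable] = integrable_to_measurable[OF w1]
    have kw: "kernel_on b (laplace_conv k w)" by (rule kernel_on_conv[OF k w1])
    have onew: "laplace_conv one w t = c * laplace_conv g p t" if "t \<in> {0..b}" for t
      using uw[OF that] u_eq[OF that] u_0 by simp
    \<comment> \<open>The goal is that \<open>d\<close> vanishes. Since \<open>w\<close> is known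
      through its primitive, the identity is first proved after convolution with 1, where
      \<open>onew\<close> and \<open>kg\<close> apply.\<close>
    define d where "d = (\<lambda>s. laplace_conv k w s - c * laplace_conv e p s)"
    have d: "kernel_on b d"
      using kw ep unfolding d_def kernel_on_def by (auto intro!: continuous_intros)
    have "laplace_conv one d t = 0" if t: "t \<in> {0..b}" for t
    proof -
      have "laplace_conv one (laplace_conv k w) t = laplace_conv (laplace_conv one k) w t"
        by (rule assoc[OF one kernel_on_integrable_to[OF k] w1 t])
      also have "\<dots> = laplace_conv (laplace_conv k one) w t" by (subst commute) auto
      also have "\<dots> = laplace_conv k (laplace_conv one w) t"
        by (rule assoc[symmetric, OF k kernel_on_integrable_to[OF one] w1 t])
      also have "\<dots> = laplace_conv k (\<lambda>s. c * laplace_conv g p s) t"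
        by (rule laplace_conv_cong) (use t onew in auto)
      also have "\<dots> = c * laplace_conv (laplace_conv k g) p t"
        unfolding laplace_conv_scale_right assoc[OF k kernel_on_integrable_to[OF g] p1 t] ..
      also have "laplace_conv (laplace_conv k g) p t = laplace_conv (laplace_conv one e) p t"
        by (rule laplace_conv_cong) (use t kg in auto)
      also have "\<dots> = laplace_conv one (laplace_conv e p) t"
        by (rule assoc[symmetric, OF one kernel_on_integrable_to[OF e] p1 t])
      finally have "laplace_conv one (laplace_conv k w) t = c * laplace_conv one (laplace_conv e p) t" .
      moreover have "integrable_to b (\<lambda>s. c * laplace_conv e p s)"
        using kernel_on_integrable_to[OF ep] by (auto simp: integrable_to_def)
      ultimately show ?thesis
        unfolding d_def using t
        by (subst laplace_conv_diff_right[OF one kernel_on_integrable_to[OF kw]])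
           (simp_all add: laplace_conv_scale_right)
    qed
    then have d0: "d t = 0" if "t \<in> {0..b}" for t
      using eq_0_if_integral_eq_0[OF b d _ that] unfolding one_def by blast
    have "ABC_derivative B b \<alpha> u t = lam * u t + f t" if "t \<in> {0<..b}" for t
    proof -
      have t: "t \<in> {0..b}" using that by simp
      have "ABC_derivative B b \<alpha> u t = B \<alpha> / (1 - \<alpha>) * (c * laplace_conv e p t)"
        using ABC[OF aew w1 t] d0[OF t] by (simp add: d_def)
      \<comment> \<open>Multiplying by \<open>D\<close> clears the factor
        \<open>c / (1 - \<alpha>) = 1 / D\<close>; \<open>Beg\<close> then separates the parts
        belonging to \<open>lam * u\<close> and to \<open>f\<close>.\<close>
      then have ABCu: "D * ABC_derivative B b \<alpha> u t = B \<alpha> * laplace_conv e p t"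
        using alpha D by (simp add: c_def)
      have "B \<alpha> * laplace_conv e p t + - (lam * (1 - \<alpha>)) * laplace_conv g p t
          = laplace_conv (\<lambda>s. B \<alpha> * e s + - (lam * (1 - \<alpha>)) * g s) p t"
        using t by (intro laplace_conv_linear_left[OF e g p1, symmetric]) auto
      also have "\<dots> = laplace_conv (\<lambda>s. D * one s + 0 * one s) p t"
        by (rule laplace_conv_cong) (use Beg t in \<open>auto simp: one_def\<close>)
      also have "\<dots> = D * laplace_conv one p t + 0 * laplace_conv one p t"
        using t by (intro laplace_conv_linear_left[OF one one p1]) auto
      finally have "B \<alpha> * laplace_conv e p t = lam * (1 - \<alpha>) * laplace_conv g p t + D * laplace_conv one p t"
        by simp
      moreover have "D * c = 1 - \<alpha>" using D by (simp add: c_def)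
      then have "D * (lam * (c * laplace_conv g p t)) = lam * (1 - \<alpha>) * laplace_conv g p t"
        by (metis mult.assoc mult.commute)
      ultimately have "D * ABC_derivative B b \<alpha> u t
          = D * (lam * (c * laplace_conv g p t) + laplace_conv one p t)"
        unfolding ABCu distrib_left by (simp only:)
      then have "ABC_derivative B b \<alpha> u t = lam * (c * laplace_conv g p t) + laplace_conv one p t"
        using D by simp
      also have "\<dots> = lam * u t + f t"
        using comp by (simp add: u_eq[OF t] fp[OF t] algebra_simps)
      finally show ?thesis .
    qed
    with uH u_0 show ?thesis by (simp add: solves_ivp_def)
  qed

  have "is_unique_solution B b \<alpha> lam f u0 u" if "lam * u0 + f 0 = 0"
    using exists[OF that] unique by (auto simp: is_unique_solution_def)
  \<comment> \<open>Having an arbitrary \<open>v\<close> here serves both equivalences at once: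
    \<open>v\<close> may be the explicit \<open>u\<close> or any unique solution.\<close>
  moreover have "lam * u0 + f 0 = 0" if "is_unique_solution B b \<alpha> lam f u0 v" for v
    using that compat by (auto simp: is_unique_solution_def)
  ultimately show ?thesis by blast
qed

end
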